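(* Let $n\geq 2$ and let $G$ be a graph. If $M(M(K_n))$ is a subgraph of $G$, then $K_m^G$ is a homotopy test graph for every positive integer $m\leq n+1$.
   Context: All graphs are finite, undirected, without multiple edges; loops are allowed unless the graph is called simple (no loops). $E(G)\subseteq V(G)\times V(G)$ is the symmetric edge relation, and $x \sim y$ means $(x,y)\in E(G)$. A subgraph $H$ of $G$ is a graph with $V(H)\subseteq V(G)$, $E(H)\subseteq E(G)$. $K_n$ is the complete graph on $\{1,\dots,n\}$ (no loops). The chromatic number $\chi(G)$ of a simple graph $G$ is the least $n$ such that there is a graph homomorphism (edge-preserving vertex map) $G\to K_n$. Categorical product: $G\times H$ has vertex set $V(G)\times V(H)$, with $(g,h)\sim(g',h')$ iff $g\sim g'$ in $G$ and $h\sim h'$ in $H$. Mycielskian: let $L_2(\{0\})$ be the graph with vertex set $\{0,1,2\}$, edges $0\sim1$, $1\sim2$ and a loop at $0$. For a graph $G$, the Mycielskian $M(G)$ is the quotient of $G\times L_2(\{0\})$ identifying all vertices with second coordinate $2$ to a single vertex (two vertices of the quotient are adjacent iff some representatives are adjacent). Exponential graph: $H^G$ has as vertices all set maps $V(G)\to V(H)$, and $f\sim f'$ in $H^G$ iff $v\sim v'$ in $G$ implies $f(v)\sim f'(v')$ in $H$. Hom complex: for graphs $G,H$, $\mathrm{Hom}(G,H)$ is the polyhedral complex whose cells are indexed by all functions $\eta:V(G)\to 2^{V(H)}\setminus\{\emptyset\}$ such that $(v,w)\in E(G)$ implies $\eta(v)\times\eta(w)\subseteq E(H)$; the cell of $\eta$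 is the product over $v\in V(G)$ of the simplices with vertex sets $\eta(v)$, and the closure of the cell of $\eta$ consists of the cells of those $\eta'$ with $\eta'(v)\subseteq\eta(v)$ for all $v$. Its $0$-cells are the graph homomorphisms $G\to H$. A space $X$ is $k$-connected if for all $0\le j\le k$ every continuous map $\mathbb{S}^j\to X$ extends to the ball $\mathbb{B}^{j+1}$; $\mathrm{conn}(X)$ is the largest $k$ such that $X$ is $k$-connected, and it is $-1$ for a nonempty disconnected space. Homotopy test graph: a graph $T$ is a homotopy test graph if $\chi(G)\geq\chi(T)+\mathrm{conn}(\mathrm{Hom}(T,G))+1$ holds for all (simple) graphs $G$. Here $\mathrm{conn}(\emptyset)=-\infty$, i.e. the condition is imposed only for those $G$ for which $\mathrm{Hom}(T,G)\neq\emptyset$.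
   Formalization: For m = 1 the inequality is required only for graphs whose Hom complex has a largest connectivity: K_1^G is a single vertex, its Hom complexes are contractible simplices, and with infinite connectivity the claim fails (already for K_1). For 2 ≤ m ≤ n+1 the full claim is proved. *)

theory Defs
  imports
    "HOL-Analysis.Analysis"
    "Graph_Theory.Pair_Digraph"
    "Graph_Theory.Digraph_Isomorphism"
begin

text \<open>
  A graph (finite, undirected, no multiple edges, loops allowed) is a record of vertex set
  \<open>pverts\<close> and edge relation \<open>parcs\<close> satisfying \<^locale>\<open>pair_pseudo_graph\<close>; it is simple
  if it satisfies \<^locale>\<open>pair_graph\<close>.
\<close>

definition graph_hom :: "'a pair_pre_digraph \<Rightarrow> 'b pair_pre_digraph \<Rightarrow> ('a \<Rightarrow> 'b) \<Rightarrow> bool" where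
  "graph_hom G H f \<longleftrightarrow>
     f ` pverts G \<subseteq> pverts H \<and> (\<forall>(x, y) \<in> parcs G. (f x, f y) \<in> parcs H)"

definition complete_graph :: "nat \<Rightarrow> nat pair_pre_digraph" where
  "complete_graph n =
     \<lparr>pverts = {1..n}, parcs = {(i, j). i \<in> {1..n} \<and> j \<in> {1..n} \<and> i \<noteq> j}\<rparr>"

text \<open>Only meaningful for simple graphs.\<close>
definition chromatic_number :: "'a pair_pre_digraph \<Rightarrow> nat" where
  "chromatic_number G = (LEAST n. \<exists>f. graph_hom G (complete_graph n) f)"

definition graph_prod ::
    "'a pair_pre_digraph \<Rightarrow> 'b pair_pre_digraph \<Rightarrow> ('a \<times> 'b) pair_pre_digraph" where
  "graph_prod G H =
     \<lparr>pverts = pverts G \<times> pverts H,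
      parcs = {((g, h), (g', h')). (g, g') \<in> parcs G \<and> (h, h') \<in> parcs H}\<rparr>"

text \<open>The vertices of a quotient graph are the classes of the equivalence relation \<open>r\<close>.\<close>
definition graph_quotient ::
    "'a pair_pre_digraph \<Rightarrow> ('a \<times> 'a) set \<Rightarrow> 'a set pair_pre_digraph" where
  "graph_quotient G r =
     \<lparr>pverts = pverts G // r,
      parcs = {(A, B). A \<in> pverts G // r \<and> B \<in> pverts G // r \<and>
                 (\<exists>a\<in>A. \<exists>b\<in>B. (a, b) \<in> parcs G)}\<rparr>"

definition L2_graph :: "nat pair_pre_digraph" where
  "L2_graph = \<lparr>pverts = {0, 1, 2}, parcs = {(0, 0), (0, 1), (1, 0), (1, 2), (2, 1)}\<rparr>"

definition mycielskian :: "'a pair_pre_digraph \<Rightarrow> ('a \<times> nat) set pair_pre_digraph" where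
  "mycielskian G =
     graph_quotient (graph_prod G L2_graph)
       {(x, y). x \<in> pverts (graph_prod G L2_graph) \<and> y \<in> pverts (graph_prod G L2_graph) \<and>
                (x = y \<or> snd x = 2 \<and> snd y = 2)}"

text \<open>\<open>exp_graph H G\<close> is $H^G$. Maps from the vertices of \<open>G\<close> are represented by
  functions that take the value \<open>undefined\<close> outside \<open>pverts G\<close>.\<close>
definition exp_graph ::
    "'b pair_pre_digraph \<Rightarrow> 'a pair_pre_digraph \<Rightarrow> ('a \<Rightarrow> 'b) pair_pre_digraph" where
  "exp_graph H G =
     \<lparr>pverts = pverts G \<rightarrow>\<^sub>E pverts H,
      parcs = {(f, f'). f \<in> pverts G \<rightarrow>\<^sub>E pverts H \<and> f' \<in> pverts G \<rightarrow>\<^sub>E pverts H \<and>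
                 (\<forall>(v, v') \<in> parcs G. (f v, f' v') \<in> parcs H)}\<rparr>"

text \<open>\<open>M\<close> is a subgraph of \<open>G\<close> up to renaming of vertices.\<close>
definition contains_copy :: "'a pair_pre_digraph \<Rightarrow> 'b pair_pre_digraph \<Rightarrow> bool" where
  "contains_copy G M \<longleftrightarrow>
     (\<exists>H. subgraph (with_proj H) (with_proj G) \<and> digraph_iso (with_proj M) (with_proj H))"

definition hom_cells ::
    "'a pair_pre_digraph \<Rightarrow> 'b pair_pre_digraph \<Rightarrow> ('a \<Rightarrow> 'b set) set" where
  "hom_cells G H =
     {\<eta> \<in> pverts G \<rightarrow>\<^sub>E (Pow (pverts H) - {{}}).
        \<forall>(v, w) \<in> parcs G. \<eta> v \<times> \<eta> w \<subseteq> parcs H}"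

text \<open>Simplex with (finite) vertex set \<open>S\<close>, in barycentric coordinates.\<close>
definition simplex_on :: "'b set \<Rightarrow> ('b \<Rightarrow> real) set" where
  "simplex_on S = {t. (\<forall>w. 0 \<le> t w) \<and> (\<forall>w. w \<notin> S \<longrightarrow> t w = 0) \<and> (\<Sum>w\<in>S. t w) = 1}"

text \<open>Closed cell of \<open>\<eta>\<close>: the product of simplices indexed by the vertices \<open>v\<close> of \<open>G\<close>;
  the coordinates at all other \<open>v\<close> are fixed to 0.\<close>
definition hom_closed_cell ::
    "'a pair_pre_digraph \<Rightarrow> ('a \<Rightarrow> 'b set) \<Rightarrow> ('a \<Rightarrow> 'b \<Rightarrow> real) set" where
  "hom_closed_cell G \<eta> =
     {p. (\<forall>v\<in>pverts G. p v \<in> simplex_on (\<eta> v)) \<and> (\<forall>v. v \<notin> pverts G \<longrightarrow> p v = (\<lambda>w. 0))}"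

text \<open>The complex has finitely many cells for finite graphs, so its topology is that of a
  subspace of the product of copies of the reals.\<close>
definition hom_complex ::
    "'a pair_pre_digraph \<Rightarrow> 'b pair_pre_digraph \<Rightarrow> ('a \<Rightarrow> 'b \<Rightarrow> real) topology" where
  "hom_complex G H = top_of_set (\<Union>\<eta>\<in>hom_cells G H. hom_closed_cell G \<eta>)"

text \<open>The closed unit ball of dimension \<open>n\<close>; its boundary for \<open>n = Suc j\<close> is \<open>nsphere j\<close>.\<close>
definition nball :: "nat \<Rightarrow> (nat \<Rightarrow> real) topology" where
  "nball n = subtopology (Euclidean_space n) {x. (\<Sum>i<n. x i ^ 2) \<le> 1}"

definition k_connected :: "int \<Rightarrow> 'a topology \<Rightarrow> bool" where
  "k_connected k X \<longleftrightarrow>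
     (\<forall>j::nat. int j \<le> k \<longrightarrow>
        (\<forall>f. continuous_map (nsphere j) X f \<longrightarrow>
           (\<exists>g. continuous_map (nball (Suc j)) X g \<and> (\<forall>x\<in>topspace (nsphere j). g x = f x))))"

text \<open>The largest \<open>k\<close> such that \<open>X\<close> is \<open>k\<close>-connected. For nonempty \<open>X\<close> it is at least
  -1, because there is no condition for \<open>k = -1\<close>, and it is \<open>\<infinity>\<close> precisely if there is
  no largest \<open>k\<close>. The empty space has connectivity \<open>-\<infinity>\<close> by convention.\<close>
definition conn :: "'a topology \<Rightarrow> ereal" where
  "conn X = (if topspace X = {} then -\<infinity> else Sup {ereal (of_int k) | k. k_connected k X})"

definition test_inequality :: "'a pair_pre_digraph \<Rightarrow> 'b pair_pre_digraph \<Rightarrow> bool" where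
  "test_inequality T G \<longleftrightarrow>
     ereal (real (chromatic_number G)) \<ge>
       ereal (real (chromatic_number T)) + conn (hom_complex T G) + 1"

text \<open>
  The type argument is the vertex type of the graphs tested against; it is arbitrary, and
  \<open>nat\<close> already covers all finite graphs up to isomorphism.

  The two notions differ in the treatment of those \<open>G\<close> for which \<open>Hom(T, G)\<close> is
  \<open>k\<close>-connected for all \<open>k\<close>. In \<open>homotopy_test_graph\<close> the inequality is required whenever a
  largest \<open>k\<close> exists (or \<open>Hom(T, G)\<close> is empty). In \<open>strong_homotopy_test_graph\<close> it is required for
  all \<open>G\<close> with the convention \<open>conn = \<infinity>\<close>, so in particular a contractible \<open>Hom(T, G)\<close> is ruled out.
  The graph with one vertex and no edge is a test graph in the first sense only, since
  \<open>Hom(K_1, G)\<close> is the full simplex on the vertices of \<open>G\<close>.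
\<close>
definition homotopy_test_graph :: "'b itself \<Rightarrow> 'a pair_pre_digraph \<Rightarrow> bool" where
  "homotopy_test_graph (_ :: 'b itself) T \<longleftrightarrow>
     pair_graph T \<and>
     (\<forall>G :: 'b pair_pre_digraph.
        pair_graph G \<and> conn (hom_complex T G) \<noteq> \<infinity> \<longrightarrow> test_inequality T G)"

definition strong_homotopy_test_graph :: "'b itself \<Rightarrow> 'a pair_pre_digraph \<Rightarrow> bool" where
  "strong_homotopy_test_graph (_ :: 'b itself) T \<longleftrightarrow>
     pair_graph T \<and>
     (\<forall>G :: 'b pair_pre_digraph. pair_graph G \<longrightarrow> test_inequality T G)"

end

theory Submission
  imports
    Defs
    "HOL-Homology.Simplices"
    "HOL-Computational_Algebra.Polynomial"
begin

text \<open>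
  Let \<open>T\<close> be the exponential graph $K_m^G$. Constant maps form a copy of $K_m$ in \<open>T\<close>, and the key
  point is that \<open>T\<close> retracts onto this copy. To colour a map \<open>f\<close> from $G$ to $m$ colours, look at its
  restriction to the part of $M(M(K_n))$ over a clique $K_{m-1}$ of $K_n$, which exists for $m \le n + 1$.
  If \<open>f\<close> is not a proper colouring of the inner Mycielskian of this part, take a suitable colour that \<open>f\<close> has at both ends of an
  edge; otherwise take the colour of the apex of the outer Mycielskian. Since the clique $K_{m-1}$ uses
  all colours but one if it is coloured properly, the constraints between two adjacent maps determine
  most of their values, and a case distinction shows that adjacent maps get different colours
  (\<open>frame_colour_neq\<close>). In particular \<open>T\<close> has no loops and has chromatic number \<open>m\<close>.

  By functoriality, $\mathrm{Hom}(K_m, H)$ is a retract of $\mathrm{Hom}(T, H)$, so the claim reduces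
  to complete graphs (\<open>test_inequality_of_retraction\<close>). For $m \ge 2$ consider the involution of
  $\mathrm{Hom}(K_m, H)$ that exchanges the first two vertices. A colouring of \<open>H\<close> with \<open>r\<close> colours and
  the moment curve yield an explicit nowhere vanishing map from the complex to the space of dimension
  $r - m + 1$ that is odd for this involution (\<open>moment_difference_nonzero\<close>): the vertex sets of a cell have
  disjoint colour sets, so at most $r - m + 2$ colours occur in the first two of them, and that many
  points of the curve are affinely independent. If the complex is \<open>k\<close>-connected, it receives equivariant maps
  from spheres of dimension up to $k + 1$ (\<open>odd_sphere_map_exists\<close>), and the Borsuk--Ulam theorem gives
  $k + 1 \le r - m$ (\<open>complete_graph_connectivity_bound\<close>).

  The Borsuk--Ulam theorem itself (\<open>odd_map_has_zero\<close>) is derived by Ky Fan's counting argument, carried out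
  in singular chains: the hemispheres of the octahedral sphere form chains whose boundaries are known
  explicitly, and iterated barycentric subdivision makes their simplices small.

  For $m = 1$ the graph \<open>T\<close> is a single vertex and $\mathrm{Hom}(T, H)$ is a full simplex, so its connectivity is
  infinite unless \<open>H\<close> has no vertices.
\<close>

section \<open>Alternating sets of signed labels\<close>

text \<open>
  A sign is a truth value; \<^term>\<open>b\<close> is the sign with which the list begins, and the empty list alternates
  for both values.
\<close>
primrec alternating :: "bool \<Rightarrow> bool list \<Rightarrow> bool" where
  "alternating b [] = True"
| "alternating b (x # xs) = (x = b \<and> alternating (\<not> b) xs)"

text \<open>
  The combinatorial core of Ky Fan's theorem. An alternating list of length at least two stays alternating
  only when an end is deleted, and the two results begin with different signs; a list with a single pair of equal
  neighbours becomes alternating when either of the two is deleted; all other lists have no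
  alternating deletion. Counting only the deletions that begin with \<^term>\<open>b\<close>, the number is thus odd
  exactly for the alternating lists. The induction peels off the head of the list.
\<close>
lemma alternating_deletions:
  fixes s :: "'a \<Rightarrow> bool"
  assumes "distinct L" "L \<noteq> []"
  shows "even ((\<Sum>j\<in>set L. of_bool (alternating b (map s (remove1 j L))))
     + of_bool (alternating True (map s L)) + of_bool (alternating False (map s L)) :: int)"
  using assms
proof (induction L arbitrary: b)
  case (Cons x L)
  show ?case
  proof (cases "L = []")
    case False
    have eq: "alternating c (map s (remove1 j (x # L))) =
        (s x = c \<and> alternating (\<not> c) (map s (remove1 j L)))" if "j \<in> set L" for j c
      using Cons.prems that by auto
    have "(\<Sum>j\<in>set (x # L). of_bool (alternating b (map s (remove1 j (x # L))))) =
        of_bool (alternating b (map s L)) +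
        (\<Sum>j\<in>set L. (of_bool (s x = b \<and> alternating (\<not> b) (map s (remove1 j L))) :: int))"
    proof -
      have "(\<Sum>j\<in>set L. of_bool (alternating b (map s (remove1 j (x # L))))) =
          (\<Sum>j\<in>set L. (of_bool (s x = b \<and> alternating (\<not> b) (map s (remove1 j L))) :: int))"
        by (intro sum.cong refl) (simp only: eq)
      then show ?thesis
        using Cons.prems by (simp del: remove1.simps(2)) simp
    qed
    moreover have "even ((\<Sum>j\<in>set L. of_bool (alternating (\<not> b) (map s (remove1 j L))))
     + of_bool (alternating True (map s L)) + of_bool (alternating False (map s L)) :: int)"
      using Cons.prems False by (intro Cons.IH) auto
    ultimately show ?thesis
      by (cases b; cases "s x") auto
  qed auto
qed simp

text \<open>
  A label is an index together with a sign. The cardinality is part of the notion so that the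
  \<^term>\<open>k\<close> vertices of a simplex carry such a label set only if their labels are pairwise distinct.
\<close>
definition alternating_set :: "bool \<Rightarrow> nat \<Rightarrow> (nat \<times> bool) set \<Rightarrow> bool" where
  "alternating_set b k S \<longleftrightarrow> card S = k \<and>
     alternating b (map (\<lambda>j. (j, True) \<in> S) (sorted_list_of_set (fst ` S)))"

text \<open>
  Fan's parity count for one simplex: its vertices are labelled by \<^term>\<open>l\<close>, and no two of them have
  labels of the same index and opposite signs. If the labels are distinct, sorting them by index
  turns facets into deletions from a list. If two vertices share a label, the facets opposite to
  them have equal label sets and cancel modulo 2.
\<close>
lemma alternating_set_facets:
  fixes l :: "nat \<Rightarrow> nat \<times> bool"
  assumes l: "\<And>i j. i \<le> Suc k \<Longrightarrow> j \<le> Suc k \<Longrightarrow> fst (l i) = fst (l j) \<Longrightarrow> l i = l j"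
  shows "even ((\<Sum>i\<le>Suc k. of_bool (alternating_set b (Suc k) (l ` ({..Suc k} - {i}))))
     + of_bool (alternating_set True (Suc (Suc k)) (l ` {..Suc k}))
     + of_bool (alternating_set False (Suc (Suc k)) (l ` {..Suc k})) :: int)"
proof (cases "inj_on l {..Suc k}")
  case True
  define S where "S = l ` {..Suc k}"
  define L where "L = sorted_list_of_set (fst ` S)"
  define s where "s j = ((j, True) \<in> S)" for j
  have cardS: "card S = Suc (Suc k)"
    using card_image [OF True] by (simp add: S_def)
  have fin: "finite S"
    by (simp add: S_def)
  have injS: "inj_on fst S"
    using l by (auto simp: S_def inj_on_def)
  have L: "distinct L" "set L = fst ` S"
    using fin by (auto simp: L_def)
  have del: "alternating_set b (Suc k) (l ` ({..Suc k} - {i})) =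
      alternating b (map s (remove1 (fst (l i)) L))" if i: "i \<le> Suc k" for i
  proof -
    have eq: "l ` ({..Suc k} - {i}) = S - {l i}"
      using True i by (auto simp: S_def inj_on_def)
    have fsteq: "fst ` (S - {l i}) = fst ` S - {fst (l i)}"
      using injS i by (auto simp: S_def inj_on_def)
    have "sorted_list_of_set (fst ` (S - {l i})) = remove1 (fst (l i)) L"
      unfolding fsteq L_def by (intro sorted_list_of_set_remove) (use fin in auto)
    moreover have "card (S - {l i}) = Suc k"
      using cardS i fin by (subst card_Diff_singleton) (auto simp: S_def)
    moreover have "map (\<lambda>j. (j, True) \<in> S - {l i}) (remove1 (fst (l i)) L) =
        map s (remove1 (fst (l i)) L)"
      using L by (intro map_cong) (auto simp: s_def, metis fst_conv)
    ultimately show ?thesis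
      unfolding alternating_set_def eq by (simp only: simp_thms)
  qed
  have bij: "bij_betw (\<lambda>i. fst (l i)) {..Suc k} (set L)"
    unfolding bij_betw_def using True l L by (auto simp: inj_on_def S_def image_image)
  have "(\<Sum>i\<le>Suc k. of_bool (alternating_set b (Suc k) (l ` ({..Suc k} - {i}))) :: int) =
      (\<Sum>i\<le>Suc k. of_bool (alternating b (map s (remove1 (fst (l i)) L))))"
    by (intro sum.cong) (auto simp: del simp del: atMost_Suc)
  also have "\<dots> = (\<Sum>j\<in>set L. of_bool (alternating b (map s (remove1 j L))))"
    by (rule sum.reindex_bij_betw [OF bij])
  finally have sum: "(\<Sum>i\<le>Suc k. of_bool (alternating_set b (Suc k) (l ` ({..Suc k} - {i}))) :: int)
      = (\<Sum>j\<in>set L. of_bool (alternating b (map s (remove1 j L))))" .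
  have "L \<noteq> []"
    using L S_def by auto
  moreover have "alternating_set c (Suc (Suc k)) S = alternating c (map s L)" for c
    by (simp add: alternating_set_def cardS L_def s_def [abs_def])
  ultimately show ?thesis
    unfolding sum S_def [symmetric] using alternating_deletions [OF L(1), of b s] by simp
next
  case False
  then obtain p q where pq: "p \<le> Suc k" "q \<le> Suc k" "p \<noteq> q" "l p = l q"
    by (auto simp: inj_on_def)
  have "card (l ` {..Suc k}) < Suc (Suc k)"
    using False card_image_le [of "{..Suc k}" l] inj_on_iff_eq_card [of "{..Suc k}" l] by simp
  then have big: "\<not> alternating_set c (Suc (Suc k)) (l ` {..Suc k})" for c
    by (simp add: alternating_set_def)
  \<comment> \<open>Only the two facets opposite to \<open>p\<close> and \<open>q\<close> can be injective, and they have the same labels.\<close>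
  have "\<not> alternating_set b (Suc k) (l ` ({..Suc k} - {i}))" if "i \<noteq> p" "i \<noteq> q" "i \<le> Suc k" for i
  proof
    assume "alternating_set b (Suc k) (l ` ({..Suc k} - {i}))"
    then have "card (l ` ({..Suc k} - {i})) = card ({..Suc k} - {i})"
      using that by (simp add: alternating_set_def)
    then have "inj_on l ({..Suc k} - {i})"
      by (simp add: eq_card_imp_inj_on)
    then show False
      using pq that by (auto simp: inj_on_def)
  qed
  then have "(\<Sum>i\<le>Suc k. of_bool (alternating_set b (Suc k) (l ` ({..Suc k} - {i}))) :: int) =
      (\<Sum>i\<in>{p, q}. of_bool (alternating_set b (Suc k) (l ` ({..Suc k} - {i}))))"
    using pq by (intro sum.mono_neutral_right) (auto simp del: atMost_Suc)
  moreover have "l ` ({..Suc k} - {p}) = l ` ({..Suc k} - {q})"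
    using pq by (auto simp: image_iff simp del: atMost_Suc) (metis DiffI atMost_iff singletonD)+
  moreover have "(\<Sum>i\<in>{p, q}. f i) = f p + f q" for f :: "nat \<Rightarrow> int"
    using pq(3) by simp
  ultimately have "(\<Sum>i\<le>Suc k. of_bool (alternating_set b (Suc k) (l ` ({..Suc k} - {i}))) :: int) =
      2 * of_bool (alternating_set b (Suc k) (l ` ({..Suc k} - {q})))"
    by (simp only: mult_2)
  then show ?thesis
    using big by (simp only: of_bool_eq) simp
qed

lemma alternating_map_Not:
  "alternating b (map (\<lambda>x. \<not> s x) L) = alternating (\<not> b) (map s L)"
  by (induction L arbitrary: b) auto

lemma alternating_set_flip:
  assumes S: "finite S" "inj_on fst S"
  shows "alternating_set b k (apsnd Not ` S) = alternating_set (\<not> b) k S"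
proof -
  have "fst ` apsnd Not ` S = fst ` S"
    by (simp add: image_image)
  moreover have "card (apsnd Not ` S) = card S"
    by (intro card_image) (auto simp: inj_on_def)
  moreover have "(j, True) \<in> apsnd Not ` S \<longleftrightarrow> (j, True) \<notin> S" if "j \<in> fst ` S" for j
  proof -
    obtain c where c: "(j, c) \<in> S"
      using \<open>j \<in> fst ` S\<close> by force
    have "(j, True) \<in> apsnd Not ` S \<longleftrightarrow> (j, False) \<in> S"
      by force
    moreover have "(j, d) \<in> S \<longleftrightarrow> d = c" for d
      using c inj_onD [OF S(2), of "(j, d)" "(j, c)"] by auto
    ultimately show ?thesis
      by auto
  qed
  then have "map (\<lambda>j. (j, True) \<in> apsnd Not ` S) (sorted_list_of_set (fst ` S)) =
      map (\<lambda>j. \<not> (j, True) \<in> S) (sorted_list_of_set (fst ` S))"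
    using S by (intro map_cong) auto
  ultimately show ?thesis
    unfolding alternating_set_def by (simp only: alternating_map_Not)
qed

section \<open>Counting labelled simplices in singular chains\<close>

text \<open>
  The number of simplices with a property, counted with their coefficients. Writing it as a
  homomorphism into the free abelian group on one generator makes it additive by construction.
\<close>
definition signed_count :: "('a \<Rightarrow> bool) \<Rightarrow> ('a \<Rightarrow>\<^sub>0 int) \<Rightarrow> int" where
  "signed_count P c = Poly_Mapping.lookup (frag_extend (\<lambda>a. if P a then frag_of () else 0) c) ()"

lemma signed_count_of [simp]: "signed_count P (frag_of a) = of_bool (P a)"
  by (simp add: signed_count_def)

lemma signed_count_0 [simp]: "signed_count P 0 = 0"
  by (simp add: signed_count_def)

lemma signed_count_add [simp]: "signed_count P (c + d) = signed_count P c + signed_count P d"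
  by (simp add: signed_count_def frag_extend_add lookup_add)

lemma signed_count_diff [simp]: "signed_count P (c - d) = signed_count P c - signed_count P d"
  by (simp add: signed_count_def frag_extend_diff lookup_minus)

lemma signed_count_cmul [simp]: "signed_count P (frag_cmul k c) = k * signed_count P c"
  by (simp add: signed_count_def frag_extend_cmul)

lemma signed_count_sum: "signed_count P (\<Sum>i\<in>I. c i) = (\<Sum>i\<in>I. signed_count P (c i))"
  by (induction I rule: infinite_finite_induct) auto

lemma signed_count_cong:
  assumes "\<And>a. a \<in> Poly_Mapping.keys c \<Longrightarrow> P a = Q a"
  shows "signed_count P c = signed_count Q c"
  unfolding signed_count_def using assms
  by (intro arg_cong [where f = "\<lambda>x. Poly_Mapping.lookup x ()"] frag_extend_eq) auto

lemma signed_count_chain_map: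
  "signed_count P (chain_map p g c) = signed_count (\<lambda>\<sigma>. P (simplex_map p g \<sigma>)) c"
  using subset_UNIV
  by (induction c rule: frag_induction) (simp_all add: chain_map_diff)

definition vertex_labels :: "('a \<Rightarrow> 'b) \<Rightarrow> nat \<Rightarrow> ((nat \<Rightarrow> real) \<Rightarrow> 'a) \<Rightarrow> 'b set" where
  "vertex_labels lab p \<sigma> = (\<lambda>i. lab (\<sigma> (\<lambda>j. if j = i then 1 else 0))) ` {..p}"

lemma vertex_labels_singular_face:
  assumes i: "i \<le> Suc p"
  shows "vertex_labels lab p (singular_face (Suc p) i \<sigma>) =
    (\<lambda>j. lab (\<sigma> (\<lambda>k. if k = j then 1 else 0))) ` ({..Suc p} - {i})"
proof -
  let ?skip = "\<lambda>j. if j < i then j else Suc j"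
  have face: "simplical_face i (\<lambda>k. if k = j then 1 else (0 :: real)) =
      (\<lambda>k. if k = ?skip j then 1 else 0)" for j
    by (rule ext) (auto simp: simplical_face_def)
  have "singular_face (Suc p) i \<sigma> (\<lambda>k. if k = j then 1 else 0) =
      \<sigma> (\<lambda>k. if k = ?skip j then 1 else 0)" if "j \<le> p" for j
    using that by (simp add: singular_face_def face)
  then have "vertex_labels lab p (singular_face (Suc p) i \<sigma>) =
      (\<lambda>j. lab (\<sigma> (\<lambda>k. if k = ?skip j then 1 else 0))) ` {..p}"
    unfolding vertex_labels_def by (intro image_cong refl arg_cong [where f = lab]) simp
  also have "\<dots> = (\<lambda>j. lab (\<sigma> (\<lambda>k. if k = j then 1 else 0))) ` (?skip ` {..p})"
    by (simp only: image_image)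
  also have "?skip ` {..p} = {..Suc p} - {i}"
  proof (intro equalityI subsetI)
    fix j assume j: "j \<in> {..Suc p} - {i}"
    show "j \<in> ?skip ` {..p}"
    proof (cases "j < i")
      case True
      then show ?thesis
        using i by (intro image_eqI [of _ _ j]) auto
    next
      case False
      then show ?thesis
        using j by (intro image_eqI [of _ _ "j - 1"]) auto
    qed
  qed (use i in \<open>auto split: if_splits\<close>)
  finally show ?thesis .
qed

text \<open>
  Fan's count extends from simplices to chains by additivity, because the signs of the faces do not
  matter modulo 2: up to parity, the positively (or negatively) alternating simplices of a boundary
  are the alternating simplices of both kinds of the chain.
\<close>
lemma signed_count_chain_boundary:
  assumes "Poly_Mapping.keys c \<subseteq> {\<sigma>. inj_on fst (vertex_labels lab (Suc p) \<sigma>)}"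
  shows "even (signed_count (\<lambda>\<sigma>. alternating_set b (Suc p) (vertex_labels lab p \<sigma>))
        (chain_boundary (Suc p) c)
      + signed_count (\<lambda>\<sigma>. alternating_set True (Suc (Suc p)) (vertex_labels lab (Suc p) \<sigma>)) c
      + signed_count (\<lambda>\<sigma>. alternating_set False (Suc (Suc p)) (vertex_labels lab (Suc p) \<sigma>)) c)"
  using assms
proof (induction c rule: frag_induction)
  case (one \<sigma>)
  define l where "l i = lab (\<sigma> (\<lambda>j. if j = i then 1 else 0))" for i
  have labels: "vertex_labels lab (Suc p) \<sigma> = l ` {..Suc p}"
    by (simp add: vertex_labels_def l_def)
  define a :: "nat \<Rightarrow> int"
    where "a i = of_bool (alternating_set b (Suc p) (l ` ({..Suc p} - {i})))" for i
  have "even ((\<Sum>i\<le>Suc p. a i) + of_bool (alternating_set True (Suc (Suc p)) (l ` {..Suc p}))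
     + of_bool (alternating_set False (Suc (Suc p)) (l ` {..Suc p})))"
    unfolding a_def
  proof (rule alternating_set_facets)
    fix i j assume "i \<le> Suc p" "j \<le> Suc p" "fst (l i) = fst (l j)"
    then show "l i = l j"
      using one by (simp add: labels inj_on_def)
  qed
  moreover have "signed_count (\<lambda>\<sigma>. alternating_set b (Suc p) (vertex_labels lab p \<sigma>))
      (chain_boundary (Suc p) (frag_of \<sigma>)) = (\<Sum>i\<le>Suc p. (- 1) ^ i * a i)"
    unfolding chain_boundary_of
    by (simp add: signed_count_sum vertex_labels_singular_face a_def l_def del: sum.atMost_Suc atMost_Suc)
  moreover have "even ((\<Sum>i\<le>Suc p. (- 1) ^ i * a i) - (\<Sum>i\<le>Suc p. a i))"
    unfolding sum_subtractf [symmetric] by (intro dvd_sum) (auto simp: minus_one_power_iff)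
  ultimately show ?case
    by (simp add: labels del: sum.atMost_Suc atMost_Suc)
next
  case (diff c d)
  then show ?case
    by (simp add: chain_boundary_diff) presburger
qed simp

definition signed_basis :: "nat set \<Rightarrow> nat \<Rightarrow> nat \<Rightarrow> real" where
  "signed_basis A j = (\<lambda>i. if i = j then (if j \<in> A then - 1 else 1) else 0)"

text \<open>
  The upper hemisphere of the boundary of the cross-polytope in the first \<^term>\<open>Suc k\<close> coordinates. Its
  simplices are indexed by the set of coordinates below \<^term>\<open>k\<close> that are negative in the orthant in
  question, and the coefficient is the orientation of that orthant.
\<close>
definition octahedral_chain :: "nat \<Rightarrow> (nat \<Rightarrow> real) chain" where
  "octahedral_chain k =
     (\<Sum>A\<in>Pow {..<k}. frag_cmul ((- 1) ^ card A) (frag_of (oriented_simplex k (signed_basis A))))"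

lemma sum_Pow_insert:
  fixes f :: "'a set \<Rightarrow> 'b :: comm_monoid_add"
  assumes "finite S" "x \<notin> S"
  shows "(\<Sum>A\<in>Pow (insert x S). f A) = (\<Sum>A\<in>Pow S. f A) + (\<Sum>A\<in>Pow S. f (insert x A))"
proof -
  have "(\<Sum>A\<in>insert x ` Pow S. f A) = (\<Sum>A\<in>Pow S. f (insert x A))"
    using assms by (subst sum.reindex) (auto simp: inj_on_def)
  moreover have "Pow S \<inter> insert x ` Pow S = {}"
    using assms by auto
  ultimately show ?thesis
    using assms by (simp add: Pow_insert sum.union_disjoint)
qed

text \<open>
  A facet opposite to one of the first \<^term>\<open>Suc k\<close> vertices belongs to two orthants with opposite
  coefficients and cancels. The facets opposite to the last vertex sweep out the whole equator, which
  consists of the hemisphere one dimension lower and its antipode.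
\<close>
lemma chain_boundary_octahedral_chain:
  "chain_boundary (Suc k) (octahedral_chain (Suc k)) =
    chain_map k (\<lambda>x i. - x i) (octahedral_chain k) + frag_cmul ((- 1) ^ Suc k) (octahedral_chain k)"
proof -
  define F where "F A i = frag_of (oriented_simplex k
      (\<lambda>j. if j < i then signed_basis A j else signed_basis A (Suc j)))" for A i
  have F_cong: "F A i = F B i"
    if "\<And>j. j \<le> k \<Longrightarrow> (if j < i then j else Suc j) \<in> A \<longleftrightarrow> (if j < i then j else Suc j) \<in> B" for A B i
    unfolding F_def frag_of_eq oriented_simplex_eq
  proof (intro allI impI)
    fix j assume "j \<le> k"
    then show "(if j < i then signed_basis A j else signed_basis A (Suc j)) =
        (if j < i then signed_basis B j else signed_basis B (Suc j))"
      using that [of j] by (cases "j < i") (auto simp: signed_basis_def)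
  qed
  have "chain_boundary (Suc k) (octahedral_chain (Suc k)) =
      (\<Sum>A\<in>Pow {..<Suc k}. \<Sum>i\<le>Suc k. frag_cmul ((- 1) ^ i) (frag_cmul ((- 1) ^ card A) (F A i)))"
    by (simp add: octahedral_chain_def chain_boundary_sum chain_boundary_cmul chain_boundary_of
      singular_face_oriented_simplex F_def frag_cmul_sum mult.commute del: sum.atMost_Suc)
  also have "\<dots> = (\<Sum>i\<le>Suc k. \<Sum>A\<in>Pow {..<Suc k}. frag_cmul ((- 1) ^ i) (frag_cmul ((- 1) ^ card A) (F A i)))"
    by (rule sum.swap)
  also have "\<dots> = (\<Sum>i\<le>Suc k. frag_cmul ((- 1) ^ i) (\<Sum>A\<in>Pow {..<Suc k}. frag_cmul ((- 1) ^ card A) (F A i)))"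
    by (simp only: frag_cmul_sum o_def)
  also have "\<dots> = frag_cmul ((- 1) ^ Suc k) (\<Sum>A\<in>Pow {..<Suc k}. frag_cmul ((- 1) ^ card A) (F A (Suc k)))"
  proof -
    have "(\<Sum>A\<in>Pow {..<Suc k}. frag_cmul ((- 1) ^ card A) (F A i)) = 0" if i: "i \<le> k" for i
    proof -
      define S where "S = {..<Suc k} - {i}"
      have S: "{..<Suc k} = insert i S" "finite S" "i \<notin> S"
        using i by (auto simp: S_def)
      have "frag_cmul ((- 1) ^ card (insert i A)) (F (insert i A) i) =
          - frag_cmul ((- 1) ^ card A) (F A i)" if "A \<in> Pow S" for A
      proof -
        have "finite A" "i \<notin> A"
          using that S by (auto intro: finite_subset)
        moreover have "F (insert i A) i = F A i"
          by (intro F_cong) auto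
        ultimately show ?thesis
          by simp
      qed
      then have "(\<Sum>A\<in>Pow S. frag_cmul ((- 1) ^ card (insert i A)) (F (insert i A) i)) =
          (\<Sum>A\<in>Pow S. - frag_cmul ((- 1) ^ card A) (F A i))"
        by (intro sum.cong refl)
      then show ?thesis
        unfolding S(1) sum_Pow_insert [OF S(2,3)] by (simp only: sum_negf right_minus)
    qed
    then show ?thesis
      by simp
  qed
  also have "(\<Sum>A\<in>Pow {..<Suc k}. frag_cmul ((- 1) ^ card A) (F A (Suc k))) =
      (\<Sum>A\<in>Pow {..<k}. frag_cmul ((- 1) ^ card A) (F A (Suc k))) +
      (\<Sum>A\<in>Pow {..<k}. frag_cmul ((- 1) ^ card (insert k A)) (F (insert k A) (Suc k)))"
    unfolding lessThan_Suc by (rule sum_Pow_insert) auto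
  also have "(\<Sum>A\<in>Pow {..<k}. frag_cmul ((- 1) ^ card A) (F A (Suc k))) = octahedral_chain k"
    unfolding octahedral_chain_def
    by (intro sum.cong refl arg_cong2 [where f = frag_cmul])
      (auto simp: F_def frag_of_eq oriented_simplex_eq)
  also have "(\<Sum>A\<in>Pow {..<k}. frag_cmul ((- 1) ^ card (insert k A)) (F (insert k A) (Suc k))) =
      frag_cmul ((- 1) ^ Suc k) (chain_map k (\<lambda>x i. - x i) (octahedral_chain k))"
  proof -
    have neg: "simplex_map k (\<lambda>x i. - x i) (oriented_simplex k (signed_basis A)) =
        oriented_simplex k (signed_basis (insert k ({..<k} - A)))" if "A \<in> Pow {..<k}" for A
    proof -
      have "simplex_map k (\<lambda>x i. - x i) (oriented_simplex k (signed_basis A)) =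
          oriented_simplex k (\<lambda>j i. - signed_basis A j i)"
        by (auto simp: simplex_map_def oriented_simplex_def sum_negf)
      also have "\<dots> = oriented_simplex k (signed_basis (insert k ({..<k} - A)))"
        using that unfolding oriented_simplex_eq by (auto simp: signed_basis_def fun_eq_iff)
      finally show ?thesis .
    qed
    have "chain_map k (\<lambda>x i. - x i) (octahedral_chain k) =
       (\<Sum>A\<in>Pow {..<k}. frag_cmul ((- 1) ^ card A)
          (frag_of (oriented_simplex k (signed_basis (insert k ({..<k} - A))))))"
      unfolding octahedral_chain_def by (subst chain_map_sum) (auto simp: neg intro!: sum.cong)
    also have "\<dots> = (\<Sum>A\<in>Pow {..<k}. frag_cmul ((- 1) ^ card ({..<k} - A))
          (frag_of (oriented_simplex k (signed_basis (insert k A)))))"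
      by (rule sum.reindex_bij_witness [where i = "\<lambda>A. {..<k} - A" and j = "\<lambda>A. {..<k} - A"])
        (auto simp: double_diff)
    finally have "frag_cmul ((- 1) ^ Suc k) (chain_map k (\<lambda>x i. - x i) (octahedral_chain k)) =
      (\<Sum>A\<in>Pow {..<k}. frag_cmul ((- 1) ^ Suc k) (frag_cmul ((- 1) ^ card ({..<k} - A))
          (frag_of (oriented_simplex k (signed_basis (insert k A))))))"
      by (simp only: frag_cmul_sum o_def)
    also have "\<dots> = (\<Sum>A\<in>Pow {..<k}. frag_cmul ((- 1) ^ card (insert k A)) (F (insert k A) (Suc k)))"
    proof (intro sum.cong refl)
      fix A assume A: "A \<in> Pow {..<k}"
      then have fin: "finite A"
        by (auto intro: finite_subset)
      have "card A \<le> k"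
        using A card_mono [of "{..<k}" A] by auto
      moreover have "card (insert k A) = Suc (card A)"
        using A fin by (intro card_insert_disjoint) auto
      ultimately have "(- 1) ^ Suc k * (- 1) ^ card ({..<k} - A) = ((- 1) ^ card (insert k A) :: int)"
        using A fin by (subst card_Diff_subset) (auto simp: minus_one_power_iff)
      moreover have "frag_of (oriented_simplex k (signed_basis (insert k A))) = F (insert k A) (Suc k)"
        by (auto simp: F_def frag_of_eq oriented_simplex_eq)
      ultimately show "frag_cmul ((- 1) ^ Suc k) (frag_cmul ((- 1) ^ card ({..<k} - A))
          (frag_of (oriented_simplex k (signed_basis (insert k A))))) =
          frag_cmul ((- 1) ^ card (insert k A)) (F (insert k A) (Suc k))"
        by (simp only: frag_cmul_cmul)
    qed
    finally show ?thesis
      by simp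
  qed
  finally show ?thesis
    by (simp add: frag_cmul_distrib2 flip: power_mult_distrib)
qed

section \<open>Zeros of odd maps\<close>

text \<open>
  The simplices avoid the origin, since a point of a simplex has a nonzero barycentric coordinate.
\<close>
lemma singular_chain_octahedral_chain:
  assumes "k \<le> d"
  shows "singular_chain k (subtopology (powertop_real UNIV) {x. \<exists>i\<le>d. x i \<noteq> 0}) (octahedral_chain k)"
  unfolding octahedral_chain_def
proof (intro singular_chain_sum singular_chain_cmul)
  fix A :: "nat set"
  have "\<exists>i\<le>d. (\<Sum>j\<le>k. signed_basis A j i * x j) \<noteq> 0" if x: "x \<in> standard_simplex k" for x
  proof -
    obtain i where i: "i \<le> k" "x i \<noteq> 0"
      using x unfolding standard_simplex_def
      by (metis (mono_tags, lifting) atMost_iff mem_Collect_eq sum.neutral zero_neq_one)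
    have "(\<Sum>j\<le>k. signed_basis A j i * x j) = (\<Sum>j\<in>{i}. signed_basis A j i * x j)"
      using i by (intro sum.mono_neutral_right) (auto simp: signed_basis_def)
    then have "(\<Sum>j\<le>k. signed_basis A j i * x j) \<noteq> 0"
      using i by (simp add: signed_basis_def)
    then show ?thesis
      using i assms by (meson order_trans)
  qed
  then show "singular_chain k (subtopology (powertop_real UNIV) {x. \<exists>i\<le>d. x i \<noteq> 0})
      (frag_of (oriented_simplex k (signed_basis A)))"
    unfolding singular_chain_of
    by (intro simplicial_imp_singular_simplex)
      (auto simp: simplicial_simplex_oriented_simplex)
qed

lemma singular_subdivision_cmul:
  "singular_subdivision p (frag_cmul k c) = frag_cmul k (singular_subdivision p c)"
  by (simp add: singular_subdivision_def frag_extend_cmul)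

abbreviation iterated_subdivision :: "nat \<Rightarrow> nat \<Rightarrow> 'a chain \<Rightarrow> 'a chain" where
  "iterated_subdivision N p \<equiv> singular_subdivision p ^^ N"

lemma singular_chain_iterated_subdivision: "singular_chain p X c \<Longrightarrow> singular_chain p X (iterated_subdivision N p c)"
  by (induction N) (auto intro: singular_chain_singular_subdivision)

lemma chain_boundary_iterated_subdivision:
  "singular_chain p X c \<Longrightarrow> chain_boundary p (iterated_subdivision N p c) = iterated_subdivision N (p - Suc 0) (chain_boundary p c)"
  by (induction N) (auto simp: chain_boundary_singular_subdivision [OF singular_chain_iterated_subdivision])

lemma iterated_subdivision_add: "iterated_subdivision N p (c + d) = iterated_subdivision N p c + iterated_subdivision N p d"
  by (induction N) (auto simp: singular_subdivision_add)

lemma iterated_subdivision_cmul: "iterated_subdivision N p (frag_cmul k c) = frag_cmul k (iterated_subdivision N p c)"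
  by (induction N) (auto simp: singular_subdivision_cmul)

lemma iterated_subdivision_chain_map:
  "singular_chain p X c \<Longrightarrow> iterated_subdivision N p (chain_map p g c) = chain_map p g (iterated_subdivision N p c)"
  by (induction N) (auto simp: naturality_singular_subdivision [OF singular_chain_iterated_subdivision])

lemma iterated_subdivision_zero: "singular_chain 0 X c \<Longrightarrow> iterated_subdivision N 0 c = c"
  by (induction N) (auto simp: singular_subdivision_zero)

text \<open>
  The Borsuk--Ulam theorem, for maps into \<^term>\<open>d\<close>-dimensional space that are odd on the complement of the
  origin in \<^term>\<open>Suc d\<close> dimensions. If there were no zero, one could label every point by the index of a
  largest coordinate of its image and by the sign of that coordinate, so that antipodal points have
  opposite labels. In a sufficiently fine subdivision of the hemispheres no simplex has two vertices
  with opposite labels, so Fan's count applies. As the boundary of a hemisphere consists of the next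
  smaller one and its antipode, induction on the dimension shows that every hemisphere contains an
  odd number of alternating simplices. In dimension \<^term>\<open>d\<close> such a simplex would need \<^term>\<open>Suc d\<close> different
  indices below \<^term>\<open>d\<close>.
\<close>
theorem odd_map_has_zero:
  fixes g :: "(nat \<Rightarrow> real) \<Rightarrow> nat \<Rightarrow> real" and d :: nat
  defines "X \<equiv> subtopology (powertop_real UNIV) {x. \<exists>i\<le>d. x i \<noteq> 0}"
  assumes cont: "\<And>l. l < d \<Longrightarrow> continuous_map X euclideanreal (\<lambda>x. g x l)"
    and odd: "\<And>x l. x \<in> topspace X \<Longrightarrow> l < d \<Longrightarrow> g (\<lambda>i. - x i) l = - g x l"
  shows "\<exists>x\<in>topspace X. \<forall>l<d. g x l = 0"
proof (rule ccontr)
  assume "\<not> ?thesis"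
  then have nonzero: "\<exists>l<d. g x l \<noteq> 0" if "x \<in> topspace X" for x
    using that by auto
  define neg where "neg = (\<lambda>(x :: nat \<Rightarrow> real) i. - x i)"
  have cont_neg: "continuous_map X X neg"
    unfolding X_def neg_def continuous_map_in_subtopology continuous_map_componentwise_UNIV
    by (auto intro!: continuous_map_minus continuous_map_from_subtopology continuous_map_product_projection)
  define dominant where "dominant x l \<longleftrightarrow> l < d \<and> (\<forall>l'<d. \<bar>g x l'\<bar> \<le> \<bar>g x l\<bar>)" for x l
  define ind where "ind x = (LEAST l. dominant x l)" for x
  have ind: "dominant x (ind x)" if x: "x \<in> topspace X" for x
  proof -
    have "{..<d} \<noteq> {}"
      using nonzero [OF x] by auto
    then have "Max ((\<lambda>l. \<bar>g x l\<bar>) ` {..<d}) \<in> (\<lambda>l. \<bar>g x l\<bar>) ` {..<d}"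
      by (intro Max_in) auto
    then obtain l where "l < d" "\<bar>g x l\<bar> = Max ((\<lambda>l. \<bar>g x l\<bar>) ` {..<d})"
      by auto
    then have "dominant x l"
      by (simp add: dominant_def)
    then show ?thesis
      unfolding ind_def by (rule LeastI)
  qed
  have pos: "\<bar>g x (ind x)\<bar> > 0" if x: "x \<in> topspace X" for x
  proof -
    obtain l where "l < d" "g x l \<noteq> 0"
      using nonzero [OF x] by blast
    then have "0 < \<bar>g x l\<bar>" "\<bar>g x l\<bar> \<le> \<bar>g x (ind x)\<bar>"
      using ind [OF x] by (auto simp: dominant_def)
    then show ?thesis
      by linarith
  qed
  define lab where "lab x = (ind x, g x (ind x) > 0)" for x
  have lab_neg: "lab (neg x) = apsnd Not (lab x)" if x: "x \<in> topspace X" for x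
  proof -
    have "dominant (neg x) l = dominant x l" for l
      using odd [OF x] by (auto simp: dominant_def neg_def)
    then have "ind (neg x) = ind x"
      by (simp add: ind_def)
    moreover have "g (neg x) (ind x) = - g x (ind x)"
      using odd [OF x] ind [OF x] by (simp add: neg_def dominant_def)
    ultimately show ?thesis
      using pos [OF x] by (auto simp: lab_def)
  qed
  \<comment> \<open>On \<open>V y\<close> the map varies by less than half the size of its value at \<open>y\<close>, so two points there that share the dominant coordinate also share its sign.\<close>
  define V where "V y = {x \<in> topspace X. \<forall>l<d. \<bar>g x l - g y l\<bar> < \<bar>g y (ind y)\<bar> / 2}" for y
  have open_V: "openin X (V y)" for y
  proof -
    have "openin X {x \<in> topspace X. \<bar>g x l - g y l\<bar> < \<bar>g y (ind y)\<bar> / 2}" if "l < d" for l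
    proof -
      have "continuous_map X euclideanreal (\<lambda>x. \<bar>g x l - g y l\<bar>)"
        by (intro continuous_intros cont that)
      from openin_continuous_map_preimage [OF this, of "{..<\<bar>g y (ind y)\<bar> / 2}"]
      show ?thesis
        by simp
    qed
    then have "openin X (topspace X \<inter> (\<Inter>l\<in>{..<d}. {x \<in> topspace X. \<bar>g x l - g y l\<bar> < \<bar>g y (ind y)\<bar> / 2}))"
      by (intro openin_Int_Inter) auto
    moreover have "topspace X \<inter> (\<Inter>l\<in>{..<d}. {x \<in> topspace X. \<bar>g x l - g y l\<bar> < \<bar>g y (ind y)\<bar> / 2}) = V y"
      by (auto simp: V_def)
    ultimately show ?thesis
      by simp
  qed
  have V_lab: "lab x = lab x'"
    if y: "y \<in> topspace X" and x: "x \<in> V y" "x' \<in> V y" and eq: "fst (lab x) = fst (lab x')" for x x' y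
  proof -
    have half: "\<bar>g y (ind y)\<bar> / 2 < \<bar>g z (ind z)\<bar>" if z: "z \<in> V y" for z
    proof -
      have "ind y < d"
        using ind [OF y] by (simp add: dominant_def)
      then have "\<bar>g z (ind y) - g y (ind y)\<bar> < \<bar>g y (ind y)\<bar> / 2" "\<bar>g z (ind y)\<bar> \<le> \<bar>g z (ind z)\<bar>"
        using z ind [of z] by (auto simp: V_def dominant_def)
      then show ?thesis
        by linarith
    qed
    have "ind x < d"
      using x ind [of x] by (auto simp: V_def dominant_def)
    then have "\<bar>g x (ind x) - g y (ind x)\<bar> < \<bar>g y (ind y)\<bar> / 2"
      "\<bar>g x' (ind x) - g y (ind x)\<bar> < \<bar>g y (ind y)\<bar> / 2"
      using x by (auto simp: V_def)
    moreover have "ind x' = ind x"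
      using eq by (simp add: lab_def)
    ultimately have "0 < g x (ind x) \<longleftrightarrow> 0 < g x' (ind x)"
      using half [OF x(1)] half [OF x(2)] by (smt (verit))
    then show ?thesis
      using \<open>ind x' = ind x\<close> by (simp add: lab_def)
  qed
  have "\<exists>n. \<forall>m f. n \<le> m \<longrightarrow> f \<in> Poly_Mapping.keys (iterated_subdivision m k (octahedral_chain k)) \<longrightarrow>
      (\<exists>y\<in>topspace X. f ` standard_simplex k \<subseteq> V y)" if k: "k \<le> d" for k
  proof -
    have "topspace X \<subseteq> \<Union> (V ` topspace X)"
      using pos by (auto simp: V_def)
    then obtain n where "\<And>m f. \<lbrakk>n \<le> m; f \<in> Poly_Mapping.keys (iterated_subdivision m k (octahedral_chain k))\<rbrakk>
        \<Longrightarrow> \<exists>W\<in>V ` topspace X. f \<in> standard_simplex k \<rightarrow> W"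
      using singular_chain_octahedral_chain [OF k, folded X_def] open_V
      by (elim sufficient_iterated_singular_subdivision_exists [rotated]) blast+
    then show ?thesis
      by (intro exI [of _ n]) (fastforce simp: Pi_iff image_subset_iff)
  qed
  then obtain n where n: "\<And>k m f. \<lbrakk>k \<le> d; n k \<le> m; f \<in> Poly_Mapping.keys (iterated_subdivision m k (octahedral_chain k))\<rbrakk>
      \<Longrightarrow> \<exists>y\<in>topspace X. f ` standard_simplex k \<subseteq> V y"
    by metis
  \<comment> \<open>One subdivision depth has to serve all hemispheres, as their boundaries are compared.\<close>
  define N where "N = Max (n ` {..d})"
  define c where "c k = iterated_subdivision N k (octahedral_chain k)" for k
  have c_chain: "singular_chain k X (c k)" if "k \<le> d" for k
    unfolding c_def X_def by (intro singular_chain_iterated_subdivision singular_chain_octahedral_chain that)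
  have labels: "inj_on fst (vertex_labels lab k \<sigma>)" if k: "k \<le> d" and \<sigma>: "\<sigma> \<in> Poly_Mapping.keys (c k)" for k \<sigma>
  proof -
    have "n k \<le> N"
      using k by (auto simp: N_def)
    then obtain y where y: "y \<in> topspace X" "\<sigma> ` standard_simplex k \<subseteq> V y"
      using n [OF k] \<sigma> unfolding c_def by blast
    then have "\<sigma> (\<lambda>j. if j = i then 1 else 0) \<in> V y" if "i \<le> k" for i
      using that by (simp add: image_subset_iff)
    then show ?thesis
      using V_lab [OF y(1)] by (auto simp: vertex_labels_def inj_on_def)
  qed
  have boundary: "chain_boundary (Suc k) (c (Suc k)) =
      chain_map k neg (c k) + frag_cmul ((- 1) ^ Suc k) (c k)" if "Suc k \<le> d" for k
  proof -
    have "singular_chain k X (octahedral_chain k)"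
      unfolding X_def by (rule singular_chain_octahedral_chain) (use that in simp)
    then show ?thesis
      unfolding c_def using chain_boundary_iterated_subdivision [OF singular_chain_octahedral_chain [OF that]]
      by (simp add: chain_boundary_octahedral_chain iterated_subdivision_add iterated_subdivision_cmul iterated_subdivision_chain_map neg_def)
  qed
  define alt where "alt b k \<sigma> \<longleftrightarrow> alternating_set b (Suc k) (vertex_labels lab k \<sigma>)" for b k \<sigma>
  have count: "odd (signed_count (alt True k) (c k) + signed_count (alt False k) (c k))" if "k \<le> d" for k
    using that
  proof (induction k)
    case 0
    have "c 0 = frag_of (oriented_simplex 0 (signed_basis {}))"
      unfolding c_def using iterated_subdivision_zero [OF singular_chain_octahedral_chain [OF le0]]
      by (simp add: octahedral_chain_def)
    moreover have "alternating_set b (Suc 0) {l}  \<longleftrightarrow> snd l = b" for b and l :: "nat \<times> bool"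
      by (cases l; cases "snd l"; cases b) (auto simp: alternating_set_def)
    ultimately show ?case
      by (auto simp: alt_def vertex_labels_def)
  next
    case (Suc k)
    then have k: "k \<le> d"
      by simp
    have "signed_count (alt True k) (chain_map k neg (c k)) = signed_count (alt False k) (c k)"
      unfolding signed_count_chain_map
    proof (rule signed_count_cong)
      fix \<sigma> assume \<sigma>: "\<sigma> \<in> Poly_Mapping.keys (c k)"
      then have sing: "singular_simplex k X \<sigma>"
        using c_chain [OF k] by (auto simp: singular_chain_def)
      have "\<sigma> (\<lambda>j. if j = i then 1 else 0) \<in> topspace X" if "i \<le> k" for i
      proof -
        have "\<sigma> \<in> standard_simplex k \<rightarrow> topspace X"
          using sing by (auto simp: singular_simplex_def continuous_map_def)
        then show ?thesis
          using that by (simp add: Pi_iff)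
      qed
      then have "vertex_labels lab k (simplex_map k neg \<sigma>) = apsnd Not ` vertex_labels lab k \<sigma>"
        by (auto simp: vertex_labels_def simplex_map_def lab_neg image_image intro!: image_cong)
      moreover have "finite (vertex_labels lab k \<sigma>)"
        by (simp add: vertex_labels_def)
      ultimately show "alt True k (simplex_map k neg \<sigma>) = alt False k \<sigma>"
        using alternating_set_flip [OF _ labels [OF k \<sigma>]] by (simp add: alt_def)
    qed
    then have "signed_count (alt True k) (chain_boundary (Suc k) (c (Suc k))) =
        signed_count (alt False k) (c k) + (- 1) ^ Suc k * signed_count (alt True k) (c k)"
      using Suc.prems by (simp add: boundary)
    moreover have "even ((- 1) ^ Suc k * signed_count (alt True k) (c k) + signed_count (alt True k) (c k))"
      by (cases "even k") auto
    moreover have "odd (signed_count (alt True k) (c k) + signed_count (alt False k) (c k))"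
      using Suc by simp
    ultimately have "odd (signed_count (alt True k) (chain_boundary (Suc k) (c (Suc k))))"
      by presburger
    moreover have "even (signed_count (alt True k) (chain_boundary (Suc k) (c (Suc k))) +
        signed_count (alt True (Suc k)) (c (Suc k)) + signed_count (alt False (Suc k)) (c (Suc k)))"
      unfolding alt_def using labels [OF Suc.prems] by (intro signed_count_chain_boundary) auto
    ultimately show ?case
      by presburger
  qed
  have "\<not> alt b d \<sigma>" if \<sigma>: "\<sigma> \<in> Poly_Mapping.keys (c d)" for b \<sigma>
  proof
    assume "alt b d \<sigma>"
    then have "card (vertex_labels lab d \<sigma>) = Suc d"
      by (simp add: alt_def alternating_set_def)
    then have "card (fst ` vertex_labels lab d \<sigma>) = Suc d"
      using card_image [OF labels [OF order_refl \<sigma>]] by simp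
    moreover have "fst ` vertex_labels lab d \<sigma> \<subseteq> {..<d}"
    proof -
      have "\<sigma> \<in> standard_simplex d \<rightarrow> topspace X"
      proof -
        have "singular_simplex d X \<sigma>"
          using c_chain [OF order_refl] \<sigma> by (auto simp: singular_chain_def)
        then show ?thesis
          by (auto simp: singular_simplex_def continuous_map_def)
      qed
      then have "ind (\<sigma> (\<lambda>j. if j = i then 1 else 0)) < d" if "i \<le> d" for i
        using that ind by (simp add: Pi_iff dominant_def)
      then show ?thesis
        by (auto simp: vertex_labels_def lab_def)
    qed
    ultimately show False
      using card_mono [of "{..<d}" "fst ` vertex_labels lab d \<sigma>"] by simp
  qed
  then have "signed_count (alt b d) (c d) = signed_count (\<lambda>_. False) (c d)" for b
    by (intro signed_count_cong) auto
  moreover have "signed_count (\<lambda>_. False) (c d) = 0"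
    by (simp add: signed_count_def frag_extend_eq_0)
  ultimately show False
    using count [of d] by simp
qed

section \<open>Odd maps from spheres into connected spaces\<close>

lemma nsphere_topspace: "topspace (nsphere j) = {x. (\<Sum>i\<le>j. (x i)\<^sup>2) = 1 \<and> (\<forall>i>j. x i = 0)}"
  by (simp add: nsphere)

lemma nball_powertop:
  "nball n = subtopology (powertop_real UNIV) {x. (\<Sum>i<n. (x i)\<^sup>2) \<le> 1 \<and> (\<forall>i\<ge>n. x i = 0)}"
  by (simp add: nball_def Euclidean_space_def subtopology_subtopology Collect_conj_eq Int_commute)

lemma continuous_map_nsphere_antipode: "continuous_map (nsphere j) (nsphere j) (\<lambda>x i. - x i)"
proof -
  have "continuous_map (nsphere j) euclideanreal (\<lambda>x. - x i)" for i
    by (intro continuous_map_minus continuous_map_nsphere_projection)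
  then show ?thesis
    unfolding nsphere [of j] continuous_map_in_subtopology continuous_map_componentwise_UNIV
    by auto
qed

text \<open>
  An equivariant map is determined by its values on the closed upper hemisphere; conversely, a map on
  that hemisphere extends as soon as it is equivariant on the equator.
\<close>
lemma odd_map_from_hemisphere:
  assumes \<tau>: "continuous_map X X \<tau>" "\<And>x. x \<in> topspace X \<Longrightarrow> \<tau> (\<tau> x) = x"
    and g: "continuous_map (subtopology (nsphere j) {x. 0 \<le> x j}) X g"
    and equator: "\<And>x. x \<in> topspace (nsphere j) \<Longrightarrow> x j = 0 \<Longrightarrow> g (\<lambda>i. - x i) = \<tau> (g x)"
  shows "\<exists>f. continuous_map (nsphere j) X f \<and>
    (\<forall>x\<in>topspace (nsphere j). f (\<lambda>i. - x i) = \<tau> (f x))"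
proof -
  define f where "f x = (if 0 \<le> x j then g x else \<tau> (g (\<lambda>i. - x i)))" for x :: "nat \<Rightarrow> real"
  have neg: "(\<lambda>i. - x i) \<in> topspace (nsphere j)" if "x \<in> topspace (nsphere j)" for x
    using that by (simp add: nsphere_topspace)
  have g_in: "g x \<in> topspace X" if "x \<in> topspace (nsphere j)" "0 \<le> x j" for x
    using g that by (auto simp: continuous_map_def Pi_iff)
  have "continuous_map (nsphere j) X f"
    unfolding f_def
  proof (rule continuous_map_cases_le)
    show "continuous_map (nsphere j) euclideanreal (\<lambda>x. x j)"
      by (rule continuous_map_nsphere_projection)
    show "continuous_map (subtopology (nsphere j) {x \<in> topspace (nsphere j). 0 \<le> x j}) X g"
      by (rule continuous_map_from_subtopology_mono [OF g]) auto
    have "continuous_map (subtopology (nsphere j) {x \<in> topspace (nsphere j). x j \<le> 0})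
        (subtopology (nsphere j) {x. 0 \<le> x j}) (\<lambda>x i. - x i)"
      unfolding continuous_map_in_subtopology
      using continuous_map_nsphere_antipode by (auto intro: continuous_map_from_subtopology)
    from continuous_map_compose [OF this continuous_map_compose [OF g \<tau>(1)]]
    show "continuous_map (subtopology (nsphere j) {x \<in> topspace (nsphere j). x j \<le> 0}) X
        (\<lambda>x. \<tau> (g (\<lambda>i. - x i)))"
      by (simp add: o_def)
  next
    fix x assume x: "x \<in> topspace (nsphere j)" "0 = x j"
    then show "g x = \<tau> (g (\<lambda>i. - x i))"
      using equator [of x] \<tau>(2) [OF g_in [of x]] by simp
  qed auto
  moreover have "f (\<lambda>i. - x i) = \<tau> (f x)" if x: "x \<in> topspace (nsphere j)" for x
    using equator [OF x] \<tau>(2) [OF g_in [OF neg [OF x]]] by (auto simp: f_def)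
  ultimately show ?thesis
    by blast
qed

text \<open>
  The equivariant map is built one dimension at a time: by connectivity, a map on the equator extends
  to a ball, the ball is projected onto the upper hemisphere, and the involution determines the map on
  the lower one. This works up to one dimension above the connectivity, since the spheres that have to
  be filled are one dimension smaller.
\<close>
lemma odd_sphere_map_exists:
  assumes conn: "k_connected k X" and ne: "topspace X \<noteq> {}"
    and \<tau>: "continuous_map X X \<tau>" "\<And>x. x \<in> topspace X \<Longrightarrow> \<tau> (\<tau> x) = x"
    and j: "int j \<le> k + 1"
  shows "\<exists>f. continuous_map (nsphere j) X f \<and>
    (\<forall>x\<in>topspace (nsphere j). f (\<lambda>i. - x i) = \<tau> (f x))"
  using j
proof (induction j)
  case 0
  obtain a where a: "a \<in> topspace X"
    using ne by blast
  show ?case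
    by (rule odd_map_from_hemisphere [OF \<tau>, of _ "\<lambda>_. a"]) (use a in \<open>auto simp: nsphere_topspace\<close>)
next
  case (Suc j)
  then obtain f where f: "continuous_map (nsphere j) X f"
    and odd: "\<And>x. x \<in> topspace (nsphere j) \<Longrightarrow> f (\<lambda>i. - x i) = \<tau> (f x)"
    by auto
  obtain g where g: "continuous_map (nball (Suc j)) X g"
    and ext: "\<And>x. x \<in> topspace (nsphere j) \<Longrightarrow> g x = f x"
    using conn [unfolded k_connected_def, rule_format, of j f] f Suc.prems by auto
  define \<pi> where "\<pi> x = (\<lambda>i. if i = Suc j then 0 else x i)" for x :: "nat \<Rightarrow> real"
  have "continuous_map (nsphere (Suc j)) (nball (Suc j)) \<pi>"
    unfolding nball_powertop continuous_map_in_subtopology continuous_map_componentwise_UNIV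
  proof (intro conjI allI)
    show "continuous_map (nsphere (Suc j)) euclideanreal (\<lambda>x. \<pi> x i)" for i
      by (cases "i = Suc j") (simp_all add: \<pi>_def continuous_map_nsphere_projection)
    have "(\<Sum>i<Suc j. (\<pi> x i)\<^sup>2) \<le> 1 \<and> (\<forall>i\<ge>Suc j. \<pi> x i = 0)"
      if x: "x \<in> topspace (nsphere (Suc j))" for x
    proof -
      have "(\<Sum>i<Suc j. (\<pi> x i)\<^sup>2) = (\<Sum>i\<le>j. (x i)\<^sup>2)"
        by (intro sum.cong) (auto simp: \<pi>_def)
      moreover have "(\<Sum>i\<le>j. (x i)\<^sup>2) + (x (Suc j))\<^sup>2 = 1"
        using x by (simp add: nsphere_topspace)
      moreover have "0 \<le> (x (Suc j))\<^sup>2"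
        by simp
      ultimately have "(\<Sum>i<Suc j. (\<pi> x i)\<^sup>2) \<le> 1"
        by linarith
      then show ?thesis
        using x by (auto simp: nsphere_topspace \<pi>_def)
    qed
    then show "\<pi> \<in> topspace (nsphere (Suc j)) \<rightarrow> {x. (\<Sum>i<Suc j. (x i)\<^sup>2) \<le> 1 \<and> (\<forall>i\<ge>Suc j. x i = 0)}"
      by blast
  qed
  from continuous_map_compose [OF this g]
  have cont: "continuous_map (subtopology (nsphere (Suc j)) {x. 0 \<le> x (Suc j)}) X (g \<circ> \<pi>)"
    by (rule continuous_map_from_subtopology)
  show ?case
  proof (rule odd_map_from_hemisphere [OF \<tau> cont])
    fix x assume x: "x \<in> topspace (nsphere (Suc j))" "x (Suc j) = 0"
    have "\<forall>i>j. x i = 0"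
    proof (intro allI impI)
      fix i assume "j < i"
      then have "i = Suc j \<or> Suc j < i"
        by auto
      then show "x i = 0"
        using x by (auto simp: nsphere_topspace)
    qed
    then have xj: "x \<in> topspace (nsphere j)"
      using x by (simp add: nsphere_topspace)
    moreover from xj have "(\<lambda>i. - x i) \<in> topspace (nsphere j)"
      by (simp add: nsphere_topspace)
    moreover have "\<pi> x = x" "\<pi> (\<lambda>i. - x i) = (\<lambda>i. - x i)"
      using x by (auto simp: \<pi>_def)
    ultimately show "(g \<circ> \<pi>) (\<lambda>i. - x i) = \<tau> ((g \<circ> \<pi>) x)"
      using odd ext by simp
  qed
qed

text \<open>
  A map of a sphere into the retract is filled in the larger space, and the filling is pushed back by
  the retraction.
\<close>
lemma k_connected_retract:
  assumes "k_connected k X" "continuous_map X Y r" "continuous_map Y X s"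
    and rs: "\<And>y. y \<in> topspace Y \<Longrightarrow> r (s y) = y"
  shows "k_connected k Y"
  unfolding k_connected_def
proof (intro allI impI)
  fix j f assume j: "int j \<le> k" and f: "continuous_map (nsphere j) Y f"
  have "continuous_map (nsphere j) X (s \<circ> f)"
    using f assms(3) by (rule continuous_map_compose)
  then obtain g where g: "continuous_map (nball (Suc j)) X g"
    and ext: "\<And>x. x \<in> topspace (nsphere j) \<Longrightarrow> g x = s (f x)"
    using assms(1) [unfolded k_connected_def, rule_format, OF j, of "s \<circ> f"] by auto
  have "continuous_map (nball (Suc j)) Y (r \<circ> g)"
    using g assms(2) by (rule continuous_map_compose)
  moreover have "(r \<circ> g) x = f x" if "x \<in> topspace (nsphere j)" for x
    using that f ext rs by (auto simp: continuous_map_def Pi_iff)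
  ultimately show "\<exists>g. continuous_map (nball (Suc j)) Y g \<and> (\<forall>x\<in>topspace (nsphere j). g x = f x)"
    by blast
qed

text \<open>
  The radial projection of the punctured space onto the sphere, which turns maps on the sphere into
  maps on the punctured space.
\<close>
definition sphere_proj :: "nat \<Rightarrow> (nat \<Rightarrow> real) \<Rightarrow> nat \<Rightarrow> real" where
  "sphere_proj d x = (\<lambda>i. if i \<le> d then x i / sqrt (\<Sum>j\<le>d. (x j)\<^sup>2) else 0)"

lemma sum_squares_pos:
  fixes x :: "nat \<Rightarrow> real"
  assumes "\<exists>i\<le>d. x i \<noteq> 0"
  shows "0 < (\<Sum>j\<le>d. (x j)\<^sup>2)"
proof -
  obtain i where "i \<le> d" "x i \<noteq> 0"
    using assms by blast
  then show ?thesis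
    by (intro sum_pos2 [of _ i]) auto
qed

lemma continuous_map_sphere_proj:
  "continuous_map (subtopology (powertop_real UNIV) {x. \<exists>i\<le>d. x i \<noteq> 0}) (nsphere d) (sphere_proj d)"
  unfolding nsphere continuous_map_in_subtopology continuous_map_componentwise_UNIV
proof (intro conjI allI)
  let ?X = "subtopology (powertop_real UNIV) {x :: nat \<Rightarrow> real. \<exists>i\<le>d. x i \<noteq> 0}"
  have proj: "continuous_map ?X euclideanreal (\<lambda>x. x i)" for i
    by (intro continuous_map_from_subtopology continuous_map_product_projection) simp
  have "continuous_map ?X euclideanreal (\<lambda>x. x i / sqrt (\<Sum>j\<le>d. (x j)\<^sup>2))" for i
  proof (intro continuous_map_real_divide proj)
    show "continuous_map ?X euclideanreal (\<lambda>x. sqrt (\<Sum>j\<le>d. (x j)\<^sup>2))"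
      by (intro continuous_map_sqrt continuous_map_sum continuous_map_real_pow proj) simp
    fix x assume "x \<in> topspace ?X"
    then show "sqrt (\<Sum>j\<le>d. (x j)\<^sup>2) \<noteq> 0"
      using sum_squares_pos [of d x] by simp
  qed
  then show "continuous_map ?X euclideanreal (\<lambda>x. sphere_proj d x i)" for i
    by (cases "i \<le> d") (simp_all add: sphere_proj_def)
  have "(\<Sum>i\<le>d. (sphere_proj d x i)\<^sup>2) = 1" if x: "\<exists>i\<le>d. x i \<noteq> 0" for x
  proof -
    have "(\<Sum>i\<le>d. (sphere_proj d x i)\<^sup>2) = (\<Sum>i\<le>d. (x i)\<^sup>2 / (\<Sum>j\<le>d. (x j)\<^sup>2))"
      by (intro sum.cong) (auto simp: sphere_proj_def power_divide sum_nonneg)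
    then show ?thesis
      using sum_squares_pos [OF x] by (simp flip: sum_divide_distrib)
  qed
  then show "sphere_proj d \<in> topspace ?X \<rightarrow> {x. (\<Sum>i\<le>d. (x i)\<^sup>2) = 1 \<and> (\<forall>i>d. x i = 0)}"
    by (auto simp: sphere_proj_def)
qed

section \<open>Hom complexes of complete graphs\<close>

lemma topspace_hom_complex:
  "topspace (hom_complex T H) = (\<Union>\<eta>\<in>hom_cells T H. hom_closed_cell T \<eta>)"
  by (simp add: hom_complex_def)

text \<open>
  Precomposition with a vertex map, which makes Hom complexes contravariant in their first argument.
  Outside the vertex set the entries have the value 0 that all points of the complex have there.
\<close>
definition hom_pullback ::
    "'a pair_pre_digraph \<Rightarrow> ('a \<Rightarrow> 'c) \<Rightarrow> ('c \<Rightarrow> 'b \<Rightarrow> real) \<Rightarrow> 'a \<Rightarrow> 'b \<Rightarrow> real" where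
  "hom_pullback T \<phi> p = (\<lambda>v. if v \<in> pverts T then p (\<phi> v) else (\<lambda>w. 0))"

lemma continuous_on_entry: "continuous_on S (\<lambda>p :: 'a \<Rightarrow> 'b \<Rightarrow> real. p v w)"
  by (intro continuous_on_product_then_coordinatewise [of S "\<lambda>p. p v"]
    continuous_on_product_then_coordinatewise [of S "\<lambda>p. p"] continuous_on_id)

lemma continuous_map_hom_pullback:
  assumes T: "pair_wf_digraph T" and \<phi>: "graph_hom T T' \<phi>"
  shows "continuous_map (hom_complex T' H) (hom_complex T H) (hom_pullback T \<phi>)"
proof -
  have "hom_pullback T \<phi> p \<in> topspace (hom_complex T H)"
    if p: "p \<in> topspace (hom_complex T' H)" for p
  proof -
    obtain \<eta> where \<eta>: "\<eta> \<in> hom_cells T' H" "p \<in> hom_closed_cell T' \<eta>"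
      using p by (auto simp: topspace_hom_complex)
    define \<theta> where "\<theta> = (\<lambda>v\<in>pverts T. \<eta> (\<phi> v))"
    have verts: "\<phi> v \<in> pverts T'" if "v \<in> pverts T" for v
      using \<phi> that by (auto simp: graph_hom_def)
    have "\<theta> v \<times> \<theta> w \<subseteq> parcs H" if vw: "(v, w) \<in> parcs T" for v w
    proof -
      have "v \<in> pverts T" "w \<in> pverts T"
        using pair_wf_digraph.in_arcsD1 [OF T vw] pair_wf_digraph.in_arcsD2 [OF T vw] .
      moreover have "(\<phi> v, \<phi> w) \<in> parcs T'"
        using \<phi> vw by (auto simp: graph_hom_def)
      ultimately show ?thesis
        using \<eta>(1) by (auto simp: hom_cells_def \<theta>_def)
    qed
    moreover have "\<theta> \<in> pverts T \<rightarrow>\<^sub>E (Pow (pverts H) - {{}})"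
      using \<eta>(1) verts by (auto simp: hom_cells_def \<theta>_def PiE_iff)
    ultimately have "\<theta> \<in> hom_cells T H"
      unfolding hom_cells_def by blast
    moreover have "hom_pullback T \<phi> p \<in> hom_closed_cell T \<theta>"
      using \<eta>(2) verts by (auto simp: hom_closed_cell_def hom_pullback_def \<theta>_def)
    ultimately show ?thesis
      by (auto simp: topspace_hom_complex)
  qed
  moreover have "continuous_on (topspace (hom_complex T' H)) (hom_pullback T \<phi>)"
  proof (intro continuous_on_coordinatewise_then_product)
    fix v w
    show "continuous_on (topspace (hom_complex T' H)) (\<lambda>p. hom_pullback T \<phi> p v w)"
      by (cases "v \<in> pverts T") (simp_all add: hom_pullback_def continuous_on_entry)
  qed
  ultimately show ?thesis
    unfolding hom_complex_def by (simp add: topspace_hom_complex Pi_iff image_subset_iff)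
qed

lemma entry_outside:
  assumes "p \<in> topspace (hom_complex T H)" "v \<notin> pverts T"
  shows "p v = (\<lambda>w. 0)"
  using assms by (auto simp: topspace_hom_complex hom_closed_cell_def)

lemma pair_wf_complete_graph: "pair_wf_digraph (complete_graph m)"
  by unfold_locales (auto simp: complete_graph_def)

lemma hom_complete_cell_disjoint:
  assumes \<eta>: "\<eta> \<in> hom_cells (complete_graph m) H" and c: "graph_hom H (complete_graph r) c"
    and i: "i \<in> {1..m}" "j \<in> {1..m}" "i \<noteq> j"
  shows "c ` \<eta> i \<inter> c ` \<eta> j = {}"
proof -
  have "c v \<noteq> c w" if "v \<in> \<eta> i" "w \<in> \<eta> j" for v w
  proof -
    have "(i, j) \<in> parcs (complete_graph m)"
      using i by (auto simp: complete_graph_def)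
    then have "(v, w) \<in> parcs H"
      using \<eta> that by (auto simp: hom_cells_def)
    then show ?thesis
      using c by (auto simp: graph_hom_def complete_graph_def)
  qed
  then show ?thesis
    by auto
qed

text \<open>
  The dimension bound behind the test property of complete graphs. A colouring of the target graph
  sends the \<^term>\<open>m\<close> vertex sets of a cell to disjoint sets of colours, and each of the \<^term>\<open>m - 2\<close> sets
  other than the first two uses up a colour.
\<close>
lemma hom_complete_cell_colours:
  assumes \<eta>: "\<eta> \<in> hom_cells (complete_graph m) H" and c: "graph_hom H (complete_graph r) c"
    and "2 \<le> m"
  shows "card (c ` \<eta> 1 \<union> c ` \<eta> 2) + (m - 2) \<le> r"
proof -
  have ne: "\<eta> i \<noteq> {}" "\<eta> i \<subseteq> pverts H" if "i \<in> {1..m}" for i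
    using \<eta> that by (auto simp: hom_cells_def complete_graph_def PiE_iff)
  then have "\<forall>i\<in>{1..m}. \<exists>w. w \<in> \<eta> i"
    by blast
  then obtain e where e: "\<And>i. i \<in> {1..m} \<Longrightarrow> e i \<in> \<eta> i"
    by metis
  have inj: "inj_on (\<lambda>i. c (e i)) {3..m}"
  proof (rule inj_onI, rule ccontr)
    fix i j assume ij: "i \<in> {3..m}" "j \<in> {3..m}" "c (e i) = c (e j)" "i \<noteq> j"
    then have "e i \<in> \<eta> i" "e j \<in> \<eta> j"
      using e by auto
    then have "c (e i) \<in> c ` \<eta> i" "c (e j) \<in> c ` \<eta> j"
      by (simp_all only: imageI)
    moreover have "c ` \<eta> i \<inter> c ` \<eta> j = {}"
      using ij by (intro hom_complete_cell_disjoint [OF \<eta> c]) auto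
    ultimately show False
      using ij(3) by (metis disjoint_iff)
  qed
  have range: "c ` \<eta> i \<subseteq> {1..r}" if "i \<in> {1..m}" for i
    using ne(2) [OF that] c by (auto simp: graph_hom_def complete_graph_def)
  have disj: "(c ` \<eta> 1 \<union> c ` \<eta> 2) \<inter> (\<lambda>i. c (e i)) ` {3..m} = {}"
  proof -
    have notin: "c (e i) \<notin> c ` \<eta> j" if "i \<in> {3..m}" "j \<in> {1, 2}" for i j
    proof -
      have "c (e i) \<in> c ` \<eta> i"
        using e [of i] that by (intro imageI) auto
      moreover have "c ` \<eta> i \<inter> c ` \<eta> j = {}"
        using that \<open>2 \<le> m\<close> by (intro hom_complete_cell_disjoint [OF \<eta> c]) auto
      ultimately show ?thesis
        by blast
    qed
    have "x \<notin> c ` \<eta> 1 \<union> c ` \<eta> 2" if "x \<in> (\<lambda>i. c (e i)) ` {3..m}" for x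
    proof -
      obtain i where "i \<in> {3..m}" "x = c (e i)"
        using \<open>x \<in> (\<lambda>i. c (e i)) ` {3..m}\<close> by blast
      then show ?thesis
        using notin [of i 1] notin [of i 2] by simp
    qed
    then show ?thesis
      unfolding disjoint_iff by metis
  qed
  have sub: "(c ` \<eta> 1 \<union> c ` \<eta> 2) \<union> (\<lambda>i. c (e i)) ` {3..m} \<subseteq> {1..r}"
  proof -
    have "c (e i) \<in> {1..r}" if "i \<in> {3..m}" for i
      using range [of i] e [of i] that by auto
    moreover have "c ` \<eta> 1 \<subseteq> {1..r}" "c ` \<eta> 2 \<subseteq> {1..r}"
      by (rule range; use \<open>2 \<le> m\<close> in simp)+
    ultimately show ?thesis
      by auto
  qed
  have "card ((\<lambda>i. c (e i)) ` {3..m}) = m - 2"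
    using inj by (simp add: card_image)
  then have "card (c ` \<eta> 1 \<union> c ` \<eta> 2) + (m - 2) =
      card ((c ` \<eta> 1 \<union> c ` \<eta> 2) \<union> (\<lambda>i. c (e i)) ` {3..m})"
    using disj sub by (subst card_Un_disjoint) (auto intro: finite_subset)
  also have "\<dots> \<le> card {1..r}"
    using sub by (intro card_mono) auto
  finally show ?thesis
    by simp
qed

text \<open>
  The weights \<^term>\<open>p 1\<close> and \<^term>\<open>p 2\<close> are transported along the colouring \<^term>\<open>c\<close> to the points
  $(t, t^2, t^3, \dots)$ of the moment curve whose parameter is the colour. The coordinates of the
  difference of the two resulting barycentres change sign when the vertices 1 and 2 are exchanged.
\<close>
definition moment_difference ::
    "'b pair_pre_digraph \<Rightarrow> ('b \<Rightarrow> nat) \<Rightarrow> (nat \<Rightarrow> 'b \<Rightarrow> real) \<Rightarrow> nat \<Rightarrow> real" where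
  "moment_difference H c p l = (\<Sum>w\<in>pverts H. (p 1 w - p 2 w) * real (c w) ^ Suc l)"

text \<open>
  At most \<^term>\<open>r - m + 2\<close> colours occur in the first two vertex sets of a cell, and that many points of the
  moment curve in dimension \<^term>\<open>r - m + 1\<close> are affinely independent. The convex hulls of the two
  disjoint groups of points are therefore disjoint. Concretely, if all coordinates of the difference vanished,
  so would the weighted sum of the values of any polynomial of degree at most \<^term>\<open>r - m + 1\<close>. A polynomial
  that vanishes at all these colours except for one of positive weight is a counterexample.
\<close>
lemma moment_difference_nonzero:
  assumes H: "finite (pverts H)" and c: "graph_hom H (complete_graph r) c" and m: "2 \<le> m"
    and p: "p \<in> topspace (hom_complex (complete_graph m) H)"
  shows "m \<le> r \<and> (\<exists>l<r - m + 1. moment_difference H c p l \<noteq> 0)"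
proof -
  obtain \<eta> where \<eta>: "\<eta> \<in> hom_cells (complete_graph m) H"
    and pc: "p \<in> hom_closed_cell (complete_graph m) \<eta>"
    using p by (auto simp: topspace_hom_complex)
  have simplex: "p i \<in> simplex_on (\<eta> i)" and sub: "\<eta> i \<subseteq> pverts H" if "i \<in> {1, 2}" for i
    using that m \<eta> pc by (auto simp: hom_closed_cell_def hom_cells_def complete_graph_def PiE_iff)
  have sum1: "(\<Sum>w\<in>pverts H. p i w) = 1" if "i \<in> {1, 2}" for i
  proof -
    have "(\<Sum>w\<in>pverts H. p i w) = (\<Sum>w\<in>\<eta> i. p i w)"
      using H simplex [OF that] sub [OF that]
      by (intro sum.mono_neutral_right) (auto simp: simplex_on_def)
    then show ?thesis
      using simplex [OF that] by (simp add: simplex_on_def)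
  qed
  have fin: "finite (\<eta> 1)" "finite (\<eta> 2)"
    using H sub by (auto intro: finite_subset)
  define C where "C = c ` \<eta> 1 \<union> c ` \<eta> 2"
  have disj: "c ` \<eta> 1 \<inter> c ` \<eta> 2 = {}"
    using hom_complete_cell_disjoint [OF \<eta> c, of 1 2] m by auto
  have cardC: "card C + (m - 2) \<le> r"
    unfolding C_def by (rule hom_complete_cell_colours [OF \<eta> c m])
  obtain w0 where w0: "w0 \<in> \<eta> 1" "p 1 w0 > 0"
  proof -
    have "\<exists>w\<in>\<eta> 1. p 1 w \<noteq> 0"
      using simplex [of 1] unfolding simplex_on_def
      by (metis (mono_tags, lifting) insertI1 mem_Collect_eq sum.neutral zero_neq_one)
    then show ?thesis
      using that simplex [of 1] by (force simp: simplex_on_def less_le)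
  qed
  have "card (c ` \<eta> 1) \<ge> 1" "card (c ` \<eta> 2) \<ge> 1"
  proof -
    have "\<eta> 2 \<noteq> {}"
      using \<eta> m by (auto simp: hom_cells_def complete_graph_def PiE_iff)
    then show "card (c ` \<eta> 2) \<ge> 1" "card (c ` \<eta> 1) \<ge> 1"
      using w0 fin by (auto simp: Suc_le_eq card_gt_0_iff)
  qed
  then have "card C \<ge> 2"
    unfolding C_def using fin disj by (subst card_Un_disjoint) auto
  then have "m \<le> r"
    using cardC m by simp
  moreover have "\<exists>l<r - m + 1. moment_difference H c p l \<noteq> 0"
  proof (rule ccontr)
    assume "\<not> ?thesis"
    then have zero: "moment_difference H c p l = 0" if "l < r - m + 1" for l
      using that by blast
    have moments: "(\<Sum>w\<in>pverts H. (p 1 w - p 2 w) * real (c w) ^ i) = 0" if "i \<le> r - m + 1" for i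
    proof (cases i)
      case 0
      then show ?thesis
        using sum1 by (simp add: sum_subtractf)
    next
      case (Suc l)
      then show ?thesis
        using zero [of l] that by (simp add: moment_difference_def)
    qed
    define q where "q = (\<Prod>b\<in>C - {c w0}. [:- real b, 1:])"
    have "degree q = card (C - {c w0})"
      unfolding q_def by (subst degree_prod_sum_eq) auto
    also have "\<dots> = card C - 1"
      using w0 by (intro card_Diff_singleton) (auto simp: C_def)
    finally have degq: "degree q \<le> r - m + 1"
      using cardC m \<open>m \<le> r\<close> by simp
    have q_root: "poly q (real b) = 0 \<longleftrightarrow> b \<in> C - {c w0}" for b
      using fin by (auto simp: q_def poly_prod C_def)
    have "(\<Sum>w\<in>pverts H. (p 1 w - p 2 w) * poly q (real (c w))) =
        (\<Sum>w\<in>pverts H. \<Sum>i\<le>degree q. coeff q i * ((p 1 w - p 2 w) * real (c w) ^ i))"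
      by (simp add: poly_altdef sum_distrib_left mult_ac)
    also have "\<dots> = (\<Sum>i\<le>degree q. coeff q i * (\<Sum>w\<in>pverts H. (p 1 w - p 2 w) * real (c w) ^ i))"
      unfolding sum_distrib_left by (rule sum.swap)
    also have "\<dots> = 0"
      using moments degq by (intro sum.neutral) auto
    finally have "0 = (\<Sum>w\<in>pverts H. (p 1 w - p 2 w) * poly q (real (c w)))"
      by simp
    also have "\<dots> = (\<Sum>w\<in>pverts H. poly q (real (c w0)) * (if c w = c w0 then p 1 w else 0))"
    proof (intro sum.cong refl)
      fix w assume "w \<in> pverts H"
      show "(p 1 w - p 2 w) * poly q (real (c w)) =
          poly q (real (c w0)) * (if c w = c w0 then p 1 w else 0)"
      proof (cases "c w = c w0")
        case True
        then have "w \<notin> \<eta> 2"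
          using disj w0 by auto
        then show ?thesis
          using True simplex [of 2] by (simp add: simplex_on_def)
      next
        case False
        show ?thesis
        proof (cases "w \<in> \<eta> 1 \<union> \<eta> 2")
          case True
          then have "poly q (real (c w)) = 0"
            using False by (auto simp: q_root C_def)
          then show ?thesis
            using False by simp
        next
          case False
          then show ?thesis
            using \<open>c w \<noteq> c w0\<close> simplex [of 1] simplex [of 2] by (simp add: simplex_on_def)
        qed
      qed
    qed
    also have "\<dots> = poly q (real (c w0)) * (\<Sum>w\<in>pverts H. if c w = c w0 then p 1 w else 0)"
      by (simp add: sum_distrib_left)
    finally have "(\<Sum>w\<in>pverts H. if c w = c w0 then p 1 w else 0) = 0"
      using q_root [of "c w0"] by simp
    moreover have "0 < (\<Sum>w\<in>pverts H. if c w = c w0 then p 1 w else 0)"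
      using H w0 sub [of 1] simplex [of 1]
      by (intro sum_pos2 [of _ w0]) (auto simp: simplex_on_def)
    ultimately show False
      by simp
  qed
  ultimately show ?thesis
    by blast
qed

text \<open>
  Exchanging the vertices 1 and 2 is an involution of the Hom complex. If the complex were too highly
  connected, there would be an equivariant map into it from a sphere of dimension \<^term>\<open>r - m + 1\<close>, and
  the nowhere vanishing odd map \<^const>\<open>moment_difference\<close> would contradict the Borsuk--Ulam theorem.
\<close>
theorem complete_graph_connectivity_bound:
  assumes H: "finite (pverts H)" and c: "graph_hom H (complete_graph r) c" and m: "2 \<le> m"
    and ne: "topspace (hom_complex (complete_graph m) H) \<noteq> {}"
    and conn: "k_connected k (hom_complex (complete_graph m) H)"
  shows "int m + k + 1 \<le> int r"
proof (rule ccontr)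
  assume less: "\<not> int m + k + 1 \<le> int r"
  define Y where "Y = hom_complex (complete_graph m) H"
  define swap where "swap i = (if i = 1 then 2 else if i = 2 then 1 else i)" for i :: nat
  define \<tau> :: "(nat \<Rightarrow> 'a \<Rightarrow> real) \<Rightarrow> nat \<Rightarrow> 'a \<Rightarrow> real"
    where "\<tau> = hom_pullback (complete_graph m) swap"
  define d where "d = r - m + 1"
  have "m \<le> r"
    using moment_difference_nonzero [OF H c m] ne by blast
  then have d: "int d \<le> k + 1"
    using less by (simp add: d_def)
  have "graph_hom (complete_graph m) (complete_graph m) swap"
    using m by (auto simp: graph_hom_def complete_graph_def swap_def)
  then have cont_\<tau>: "continuous_map Y Y \<tau>"
    unfolding Y_def \<tau>_def by (intro continuous_map_hom_pullback pair_wf_complete_graph)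
  have "\<tau> (\<tau> p) = p" if "p \<in> topspace Y" for p
  proof
    fix i
    show "\<tau> (\<tau> p) i = p i"
      using m entry_outside [OF that [unfolded Y_def], of i]
      by (auto simp: \<tau>_def hom_pullback_def swap_def complete_graph_def)
  qed
  then obtain f where f: "continuous_map (nsphere d) Y f"
    and odd: "\<And>x. x \<in> topspace (nsphere d) \<Longrightarrow> f (\<lambda>i. - x i) = \<tau> (f x)"
    using odd_sphere_map_exists [OF conn ne, folded Y_def, OF cont_\<tau> _ d] by blast
  define g where "g x = moment_difference H c (f (sphere_proj d x))" for x
  let ?X = "subtopology (powertop_real UNIV) {x :: nat \<Rightarrow> real. \<exists>i\<le>d. x i \<noteq> 0}"
  have "\<exists>x\<in>topspace ?X. \<forall>l<d. g x l = 0"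
  proof (rule odd_map_has_zero)
    fix l
    have "continuous_on (topspace Y) (\<lambda>p. moment_difference H c p l)"
      unfolding moment_difference_def by (intro continuous_intros continuous_on_entry)
    then have "continuous_map Y euclideanreal (\<lambda>p. moment_difference H c p l)"
      by (simp add: Y_def hom_complex_def)
    from continuous_map_compose [OF continuous_map_compose [OF continuous_map_sphere_proj f] this]
    show "continuous_map ?X euclideanreal (\<lambda>x. g x l)"
      by (simp add: g_def o_def)
  next
    fix x l assume x: "x \<in> topspace ?X"
    have "sphere_proj d (\<lambda>i. - x i) = (\<lambda>i. - sphere_proj d x i)"
      by (auto simp: sphere_proj_def)
    moreover have "sphere_proj d x \<in> topspace (nsphere d)"
      using continuous_map_sphere_proj x by (auto simp: continuous_map_def Pi_iff)
    ultimately have "f (sphere_proj d (\<lambda>i. - x i)) = \<tau> (f (sphere_proj d x))"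
      using odd by simp
    moreover have "moment_difference H c (\<tau> p) l = - moment_difference H c p l" for p
      using m unfolding moment_difference_def sum_negf [symmetric]
      by (intro sum.cong) (auto simp: \<tau>_def hom_pullback_def swap_def complete_graph_def algebra_simps)
    ultimately show "g (\<lambda>i. - x i) l = - g x l"
      by (simp add: g_def)
  qed
  then obtain x where x: "x \<in> topspace ?X" "\<And>l. l < d \<Longrightarrow> g x l = 0"
    by blast
  have "f (sphere_proj d x) \<in> topspace Y"
    using x(1) continuous_map_compose [OF continuous_map_sphere_proj f]
    by (auto simp: continuous_map_def Pi_iff)
  then show False
    using moment_difference_nonzero [OF H c m] x(2) unfolding Y_def d_def g_def by blast
qed

section \<open>Colourings of a doubly iterated Mycielskian\<close>

text \<open>
  The part of $M(M(K))$ on which colourings are evaluated, for a set \<^term>\<open>I\<close> of vertices of a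
  complete graph $K$ with an edge. In $M(K)$ each vertex of $K$ has a base vertex and a copy at level 1, and
  all these copies are joined to an apex. The vertices \<^term>\<open>A i\<close>, \<^term>\<open>B i\<close> and \<^term>\<open>z\<close> are
  these three kinds of vertices at level 0 of the second Mycielskian and are called the inner part below;
  \<^term>\<open>A1 i\<close>, \<^term>\<open>B1 i\<close> and \<^term>\<open>z1\<close> are their copies at level 1, and \<^term>\<open>w\<close> is the
  apex of the second Mycielskian. The ambient graph only has to contain the listed edges. The last
  condition makes all these vertices endpoints of edges even if \<^term>\<open>I\<close> has at most one element.
\<close>
locale mycielski_frame =
  fixes I :: "'i set" and E :: "('v \<times> 'v) set"
    and A B A1 B1 :: "'i \<Rightarrow> 'v" and z z1 w :: 'v
  assumes finite_I: "finite I" and sym_E: "sym E"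
    and edges: "\<And>i j. i \<in> I \<Longrightarrow> j \<in> I \<Longrightarrow> i \<noteq> j \<Longrightarrow>
        {(A i, A j), (A i, B j), (A1 i, A j), (A1 i, B j), (B1 i, A j)} \<subseteq> E"
    and apex_edges: "\<And>i. i \<in> I \<Longrightarrow>
        {(B i, z), (B1 i, z), (B i, z1), (A1 i, w), (B1 i, w)} \<subseteq> E"
    and top_edge: "(z1, w) \<in> E"
    and in_domain: "insert z (A ` I) \<subseteq> Domain E"
begin

text \<open>
  The colours \<^term>\<open>c\<close> that a map takes twice on the clique of base vertices; a map adjacent to it in the
  exponential graph then avoids \<^term>\<open>c\<close> at all indices.
\<close>
definition repeated :: "('v \<Rightarrow> 'c) \<Rightarrow> 'c \<Rightarrow> bool" where
  "repeated f c \<longleftrightarrow> (\<exists>i\<in>I. \<exists>j\<in>I. i \<noteq> j \<and> f (A i) = c \<and> f (A j) = c)"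

text \<open>
  The colours of the monochromatic edges between a base vertex and a copy at level 1.
\<close>
definition crossing :: "('v \<Rightarrow> 'c) \<Rightarrow> 'c \<Rightarrow> bool" where
  "crossing f c \<longleftrightarrow> (\<exists>i\<in>I. \<exists>j\<in>I. i \<noteq> j \<and> f (B i) = c \<and> f (A j) = c)"

text \<open>
  The colour of an arbitrary map, which need not be a proper colouring. It is always a value of the map.
  If the map is not proper on the inner part, a colour that violates properness is chosen, on the clique of base
  vertices if possible; such a colour obstructs the same choice for adjacent maps. For a map that is
  proper on the inner part, the colour of the outermost apex decides.
\<close>
definition frame_colour :: "('v \<Rightarrow> 'c) \<Rightarrow> 'c" where
  "frame_colour f =
     (if \<exists>c. repeated f c then SOME c. repeated f c
      else if \<exists>c. crossing f c then SOME c. crossing f c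
      else if \<exists>i\<in>I. f (B i) = f z then f z
      else f w)"

lemma frame_colour_cases:
  obtains (repeated) "repeated f (frame_colour f)"
  | (crossing) "inj_on (f \<circ> A) I" "crossing f (frame_colour f)"
  | (apex) i where "inj_on (f \<circ> A) I" "i \<in> I" "f (B i) = frame_colour f" "f z = frame_colour f"
  | (proper) "inj_on (f \<circ> A) I" "\<And>i j. i \<in> I \<Longrightarrow> j \<in> I \<Longrightarrow> i \<noteq> j \<Longrightarrow> f (B i) \<noteq> f (A j)"
      "\<And>i. i \<in> I \<Longrightarrow> f (B i) \<noteq> f z" "f w = frame_colour f"
proof (cases "\<exists>c. repeated f c")
  case True
  then have "repeated f (SOME c. repeated f c)"
    by (rule someI_ex)
  then have "repeated f (frame_colour f)"
    unfolding frame_colour_def if_P [OF True] .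
  then show ?thesis
    by (rule that(1))
next
  case False
  then have inj: "inj_on (f \<circ> A) I"
    by (auto simp: repeated_def inj_on_def)
  show ?thesis
  proof (cases "\<exists>c. crossing f c")
    case True
    then have "crossing f (SOME c. crossing f c)"
      by (rule someI_ex)
    then have "crossing f (frame_colour f)"
      unfolding frame_colour_def if_not_P [OF False] if_P [OF True] .
    with inj show ?thesis
      by (rule that(2))
  next
    case no_crossing: False
    show ?thesis
    proof (cases "\<exists>i\<in>I. f (B i) = f z")
      case True
      moreover from True have "frame_colour f = f z"
        unfolding frame_colour_def if_not_P [OF False] if_not_P [OF no_crossing] by (rule if_P)
      ultimately show ?thesis
        using that(3) [OF inj] by metis
    next
      case no_apex: False
      show ?thesis
      proof (rule that(4) [OF inj])
        show "f (B i) \<noteq> f (A j)" if "i \<in> I" "j \<in> I" "i \<noteq> j" for i j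
          using no_crossing that unfolding crossing_def by blast
        show "f (B i) \<noteq> f z" if "i \<in> I" for i
          using no_apex that by blast
        show "f w = frame_colour f"
          unfolding frame_colour_def if_not_P [OF False] if_not_P [OF no_crossing] if_not_P [OF no_apex] ..
      qed
    qed
  qed
qed

lemma frame_colour_value: "frame_colour f \<in> f ` (A ` I \<union> {z, w})"
proof (cases f rule: frame_colour_cases)
  case repeated
  then obtain i where "i \<in> I" "frame_colour f = f (A i)"
    by (auto simp: repeated_def)
  then show ?thesis
    by (intro image_eqI [of _ _ "A i"]) auto
next
  case crossing
  then obtain i where "i \<in> I" "frame_colour f = f (A i)"
    by (auto simp: crossing_def)
  then show ?thesis
    by (intro image_eqI [of _ _ "A i"]) auto
next
  case (apex i)
  then show ?thesis
    by (intro image_eqI [of _ _ z]) auto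
next
  case proper
  then show ?thesis
    by (intro image_eqI [of _ _ w]) auto
qed

definition vertices :: "'v set" where
  "vertices = A ` I \<union> B ` I \<union> A1 ` I \<union> B1 ` I \<union> {z, z1, w}"

lemma vertices_colours:
  assumes "f ` vertices \<subseteq> C"
  shows "f z \<in> C" "f z1 \<in> C" "f w \<in> C"
    and "i \<in> I \<Longrightarrow> f (A i) \<in> C" "i \<in> I \<Longrightarrow> f (B i) \<in> C"
    "i \<in> I \<Longrightarrow> f (A1 i) \<in> C" "i \<in> I \<Longrightarrow> f (B1 i) \<in> C"
  using assms by (simp_all add: vertices_def image_subset_iff)

text \<open>
  With one colour more than there are indices, an injective map on the base clique misses exactly one
  colour. The next proofs use this repeatedly: forbidding all other colours at a vertex determines
  its colour.
\<close>
lemma base_colours: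
  assumes inj: "inj_on (f \<circ> A) I" and C: "finite C" "card C = Suc (card I)"
    and f: "f ` vertices \<subseteq> C" and b: "b \<in> C" "b \<notin> f ` A ` I"
    and v: "v \<in> C"
  shows "v = b \<or> (\<exists>k\<in>I. v = f (A k))"
proof -
  have sub: "insert b (f ` A ` I) \<subseteq> C"
    using b vertices_colours [OF f] by auto
  have "card (insert b (f ` A ` I)) = card C"
    using card_image [OF inj] finite_I C b by (simp add: image_comp)
  then have "insert b (f ` A ` I) = C"
    using C sub by (intro card_subset_eq)
  then show ?thesis
    using v by auto
qed

lemma missing_colour:
  assumes inj: "inj_on (f \<circ> A) I" and C: "finite C" "card C = Suc (card I)"
  obtains b where "b \<in> C" "b \<notin> f ` A ` I"
proof -
  have "card (f ` A ` I) < card C"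
    using card_image [OF inj] C by (simp add: image_comp)
  then have "\<not> C \<subseteq> f ` A ` I"
    using finite_I by (metis card_mono finite_imageI not_le)
  then show ?thesis
    using that by blast
qed

text \<open>
  Adjacency in the exponential graph whose target is a complete graph.
\<close>
definition adjacent :: "('v \<Rightarrow> 'c) \<Rightarrow> ('v \<Rightarrow> 'c) \<Rightarrow> bool" where
  "adjacent f f' \<longleftrightarrow> (\<forall>(x, y)\<in>E. f x \<noteq> f' y)"

lemma adjacent_commute: "adjacent f f' \<Longrightarrow> adjacent f' f"
  using sym_E by (fastforce simp: adjacent_def sym_def)

lemma adjacentD:
  assumes "adjacent f f'" "(x, y) \<in> E"
  shows "f x \<noteq> f' y" "f y \<noteq> f' x"
  using assms adjacent_commute [OF assms(1)] by (force simp: adjacent_def)+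

lemma adjacent_neq:
  assumes adj: "adjacent f f'" and i: "i \<in> I"
  shows "f (B i) \<noteq> f' z" "f z \<noteq> f' (B i)" "f (B1 i) \<noteq> f' z" "f z \<noteq> f' (B1 i)"
    "f (B i) \<noteq> f' z1" "f z1 \<noteq> f' (B i)" "f (A1 i) \<noteq> f' w" "f w \<noteq> f' (A1 i)"
    "f (B1 i) \<noteq> f' w" "f w \<noteq> f' (B1 i)"
    and "j \<in> I \<Longrightarrow> i \<noteq> j \<Longrightarrow> f (A i) \<noteq> f' (A j)"
    "j \<in> I \<Longrightarrow> i \<noteq> j \<Longrightarrow> f (A i) \<noteq> f' (B j)"
    "j \<in> I \<Longrightarrow> i \<noteq> j \<Longrightarrow> f (B i) \<noteq> f' (A j)"
    "j \<in> I \<Longrightarrow> i \<noteq> j \<Longrightarrow> f (A1 i) \<noteq> f' (A j)"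
    "j \<in> I \<Longrightarrow> i \<noteq> j \<Longrightarrow> f (A i) \<noteq> f' (A1 j)"
    "j \<in> I \<Longrightarrow> i \<noteq> j \<Longrightarrow> f (A1 i) \<noteq> f' (B j)"
    "j \<in> I \<Longrightarrow> i \<noteq> j \<Longrightarrow> f (B i) \<noteq> f' (A1 j)"
    "j \<in> I \<Longrightarrow> i \<noteq> j \<Longrightarrow> f (B1 i) \<noteq> f' (A j)"
    "j \<in> I \<Longrightarrow> i \<noteq> j \<Longrightarrow> f (A i) \<noteq> f' (B1 j)"
proof -
  have apex: "(B i, z) \<in> E" "(B1 i, z) \<in> E" "(B i, z1) \<in> E" "(A1 i, w) \<in> E" "(B1 i, w) \<in> E"
    using apex_edges [OF i] by auto
  from apex [THEN adjacentD(1) [OF adj]] apex [THEN adjacentD(2) [OF adj]]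
  show "f (B i) \<noteq> f' z" "f z \<noteq> f' (B i)" "f (B1 i) \<noteq> f' z" "f z \<noteq> f' (B1 i)"
    "f (B i) \<noteq> f' z1" "f z1 \<noteq> f' (B i)" "f (A1 i) \<noteq> f' w" "f w \<noteq> f' (A1 i)"
    "f (B1 i) \<noteq> f' w" "f w \<noteq> f' (B1 i)"
    by simp_all
  assume j: "j \<in> I" "i \<noteq> j"
  have base: "(A i, A j) \<in> E" "(A i, B j) \<in> E" "(A1 i, A j) \<in> E" "(A1 i, B j) \<in> E" "(B1 i, A j) \<in> E"
      "(A j, B i) \<in> E" "(A1 j, A i) \<in> E" "(A1 j, B i) \<in> E" "(B1 j, A i) \<in> E"
    using edges [OF i j] edges [OF j(1) i] j(2) by auto
  from base [THEN adjacentD(1) [OF adj]] base [THEN adjacentD(2) [OF adj]]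
  show "f (A i) \<noteq> f' (A j)" "f (A i) \<noteq> f' (B j)" "f (B i) \<noteq> f' (A j)" "f (A1 i) \<noteq> f' (A j)"
    "f (A i) \<noteq> f' (A1 j)" "f (A1 i) \<noteq> f' (B j)" "f (B i) \<noteq> f' (A1 j)" "f (B1 i) \<noteq> f' (A j)"
    "f (A i) \<noteq> f' (B1 j)"
    by simp_all
qed

lemma adjacent_top: "adjacent f f' \<Longrightarrow> f z1 \<noteq> f' w \<and> f w \<noteq> f' z1"
  using top_edge adjacent_commute [of f f'] unfolding adjacent_def by auto

text \<open>
  If a map is assigned \<^term>\<open>c\<close> but \<^term>\<open>c\<close> violates properness in none of the three ways, then
  the map is proper on the inner part and \<^term>\<open>c\<close> is its value at the outermost apex.
\<close>
lemma proper_mapD: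
  assumes "frame_colour f = c" "\<not> repeated f c" "\<not> crossing f c"
    "\<forall>i\<in>I. f (B i) \<noteq> c \<or> f z \<noteq> c"
  shows "inj_on (f \<circ> A) I" "f w = c"
    and "i \<in> I \<Longrightarrow> j \<in> I \<Longrightarrow> i \<noteq> j \<Longrightarrow> f (B i) \<noteq> f (A j)"
    and "i \<in> I \<Longrightarrow> f (B i) \<noteq> f z"
  using assms by (cases f rule: frame_colour_cases; simp; fail)+

context
  fixes C :: "'c set" and f f' :: "'v \<Rightarrow> 'c"
  assumes C: "finite C" "card C = Suc (card I)"
    and f: "f ` vertices \<subseteq> C" and f': "f' ` vertices \<subseteq> C"
    and adj: "adjacent f f'"
begin

text \<open>
  A repeated base colour of \<^term>\<open>f\<close> is avoided by \<^term>\<open>f'\<close> on the clique and its copies, so \<^term>\<open>f'\<close>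
  could only get it at the outermost apex. Then the colours of \<^term>\<open>f'\<close> at \<^term>\<open>B\<close> and at \<^term>\<open>A\<close> agree,
  which forces \<^term>\<open>f z1 = c\<close>, a clash along the edge from \<^term>\<open>z1\<close> to \<^term>\<open>w\<close>.
\<close>
lemma colour_of_repeated:
  assumes rep: "repeated f c"
  shows "frame_colour f' \<noteq> c"
proof
  assume eq: "frame_colour f' = c"
  have avoid: "f' (A k) \<noteq> c" "f' (B k) \<noteq> c" if "k \<in> I" for k
  proof -
    obtain i where "i \<in> I" "i \<noteq> k" "f (A i) = c"
      using rep by (auto simp: repeated_def)
    then show "f' (A k) \<noteq> c" "f' (B k) \<noteq> c"
      using adjacent_neq(11,12) [OF adj, of i k] that by auto
  qed
  have not: "\<not> repeated f' c" "\<not> crossing f' c" "\<forall>i\<in>I. f' (B i) \<noteq> c \<or> f' z \<noteq> c"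
    using avoid by (auto simp: repeated_def crossing_def)
  note proper = proper_mapD [OF eq not]
  have "c \<in> C"
    using vertices_colours(3) [OF f'] proper(2) by simp
  moreover have "c \<notin> f' ` A ` I"
    using avoid(1) by auto
  ultimately have base: "v = c \<or> (\<exists>k\<in>I. v = f' (A k))" if "v \<in> C" for v
    using base_colours [OF proper(1) C f'] that by blast
  have B: "f' (B k) = f' (A k)" if k: "k \<in> I" for k
    using base [OF vertices_colours(5) [OF f' k]] proper(3) [OF k] avoid(2) [OF k] by metis
  have "f z1 = c"
    using base [OF vertices_colours(2) [OF f]] adjacent_neq(6) [OF adj] B by metis
  then show False
    using adjacent_top [OF adj] proper(2) by simp
qed

text \<open>
  The two ends of the monochromatic edge together exclude \<^term>\<open>c\<close> from all base vertices of \<^term>\<open>f'\<close> and from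
  its value at \<^term>\<open>z\<close>. On the other hand, \<^term>\<open>f\<close> has to copy the base colours of \<^term>\<open>f'\<close> at
  \<^term>\<open>B1\<close>, which leaves only \<^term>\<open>c\<close> for the value of \<^term>\<open>f'\<close> at \<^term>\<open>z\<close>.
\<close>
lemma colour_of_crossing:
  assumes cross: "crossing f c"
  shows "frame_colour f' \<noteq> c"
proof
  assume eq: "frame_colour f' = c"
  obtain i j where ij: "i \<in> I" "j \<in> I" "i \<noteq> j" "f (B i) = c" "f (A j) = c"
    using cross by (auto simp: crossing_def)
  have avoid: "f' (A k) \<noteq> c" if "k \<in> I" for k
    using adjacent_neq(11) [OF adj ij(2) that] adjacent_neq(13) [OF adj ij(1) that] ij by metis
  have z: "f' z \<noteq> c"
    using adjacent_neq(1) [OF adj ij(1)] ij(4) by simp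
  have not: "\<not> repeated f' c" "\<not> crossing f' c" "\<forall>i\<in>I. f' (B i) \<noteq> c \<or> f' z \<noteq> c"
    using avoid z by (auto simp: repeated_def crossing_def)
  note proper = proper_mapD [OF eq not]
  have "c \<in> C"
    using vertices_colours(3) [OF f'] proper(2) by simp
  moreover have "c \<notin> f' ` A ` I"
    using avoid by auto
  ultimately have base: "v = c \<or> (\<exists>k\<in>I. v = f' (A k))" if "v \<in> C" for v
    using base_colours [OF proper(1) C f'] that by blast
  have B1: "f (B1 k) = f' (A k)" if k: "k \<in> I" for k
    using base [OF vertices_colours(7) [OF f k]] adjacent_neq(9) [OF adj k] adjacent_neq(18) [OF adj k]
      proper(2) by metis
  have "f' z \<noteq> f' (A k)" if k: "k \<in> I" for k
    using adjacent_neq(3) [OF adj k] B1 [OF k] by simp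
  then show False
    using base [OF vertices_colours(1) [OF f']] z by blast
qed

text \<open>
  Again \<^term>\<open>f'\<close> must be proper with \<^term>\<open>c\<close> at the outermost apex, while \<^term>\<open>c\<close> is excluded at
  \<^term>\<open>z\<close>. All other colours turn out to occur under \<^term>\<open>f'\<close> at the neighbours \<^term>\<open>B\<close> of \<^term>\<open>z\<close>. If \<^term>\<open>f'\<close>
  takes \<^term>\<open>c\<close> at the base vertex \<^term>\<open>i\<close>, then the colour missing on its clique appears at \<^term>\<open>B i\<close>
  instead.
\<close>
lemma colour_of_apex:
  assumes i: "i \<in> I" "f (B i) = c" "f z = c"
  shows "frame_colour f' \<noteq> c"
proof
  assume eq: "frame_colour f' = c"
  have z: "f' z \<noteq> c"
    using adjacent_neq(1) [OF adj i(1)] i(2) by simp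
  have avoid_B: "f' (B k) \<noteq> c" if "k \<in> I" for k
    using adjacent_neq(2) [OF adj that] i by simp
  have avoid_A: "f' (A k) \<noteq> c" if "k \<in> I" "i \<noteq> k" for k
    using adjacent_neq(13) [OF adj i(1) that] i by simp
  have not: "\<not> repeated f' c" "\<not> crossing f' c" "\<forall>i\<in>I. f' (B i) \<noteq> c \<or> f' z \<noteq> c"
    using avoid_A avoid_B by (auto simp: repeated_def crossing_def)
  note proper = proper_mapD [OF eq not]
  have c: "c \<in> C"
    using vertices_colours(3) [OF f'] proper(2) by simp
  show False
  proof (cases "f' (A i) = c")
    case False
    then have "c \<notin> f' ` A ` I"
      using avoid_A by auto
    note base = base_colours [OF proper(1) C f' c this]
    have B: "f' (B k) = f' (A k)" if k: "k \<in> I" for k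
      using base [OF vertices_colours(5) [OF f' k]] avoid_B [OF k] proper(3) [OF k] by metis
    have "f' z \<noteq> f' (A k)" if k: "k \<in> I" for k
      using proper(4) [OF k] B [OF k] by simp
    then show False
      using base [OF vertices_colours(1) [OF f']] z by blast
  next
    case True
    obtain b where b: "b \<in> C" "b \<notin> f' ` A ` I"
      using missing_colour [OF proper(1) C] by metis
    note base = base_colours [OF proper(1) C f' b]
    have Bi: "f' (B i) = b"
      using base [OF vertices_colours(5) [OF f' i(1)]] avoid_B [OF i(1)] proper(3) [OF i(1)] True by metis
    have A1: "f (A1 i) = b"
      using base [OF vertices_colours(6) [OF f i(1)]] adjacent_neq(14) [OF adj i(1)]
        adjacent_neq(7) [OF adj i(1)] proper(2) True by metis
    have B: "f' (B k) = f' (A k)" if k: "k \<in> I" "i \<noteq> k" for k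
      using base [OF vertices_colours(5) [OF f' k(1)]] adjacent_neq(16) [OF adj i(1) k] A1
        proper(3) [OF k(1)] by metis
    have "f' z \<noteq> b"
      using proper(4) [OF i(1)] Bi by simp
    moreover have "f' z \<noteq> f' (A k)" if k: "k \<in> I" for k
      using proper(4) [OF k] B [OF k] True z by (cases "i = k") auto
    ultimately show False
      using base [OF vertices_colours(1) [OF f']] by blast
  qed
qed

text \<open>
  If \<^term>\<open>c\<close> were the missing base colour of \<^term>\<open>f\<close>, the base colours would propagate to \<^term>\<open>B1\<close> and
  \<^term>\<open>B\<close> under \<^term>\<open>f'\<close> and leave only \<^term>\<open>c\<close> for \<^term>\<open>f\<close> at \<^term>\<open>z1\<close>, next to the apex \<^term>\<open>w\<close>.
\<close>
lemma base_takes_apex_colour: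
  assumes inj: "inj_on (f \<circ> A) I" and w: "f w = c" "f' w = c"
  shows "\<exists>x\<in>I. f (A x) = c"
proof (rule ccontr)
  assume "\<not> ?thesis"
  then have avoid: "c \<notin> f ` A ` I"
    by blast
  have "c \<in> C"
    using vertices_colours(3) [OF f] w by simp
  note base = base_colours [OF inj C f this avoid]
  have B1: "f' (B1 k) = f (A k)" if k: "k \<in> I" for k
    using base [OF vertices_colours(7) [OF f' k]] adjacent_neq(10) [OF adj k] adjacent_neq(19) [OF adj _ k]
      k w by metis
  have z: "f z = c"
    using base [OF vertices_colours(1) [OF f]] adjacent_neq(4) [OF adj] B1 by metis
  have B: "f' (B k) = f (A k)" if k: "k \<in> I" for k
    using base [OF vertices_colours(5) [OF f' k]] adjacent_neq(2) [OF adj k] adjacent_neq(12) [OF adj _ k]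
      k z by metis
  have "f z1 = c"
    using base [OF vertices_colours(2) [OF f]] adjacent_neq(6) [OF adj] B by metis
  then show False
    using adjacent_top [OF adj] w by simp
qed

text \<open>
  Here both maps are proper on the inner part and have the same colour at the outermost apex and at a base vertex
  \<^term>\<open>x\<close>. Either the two maps miss the same base colour; then they agree on the clique, and no colour
  is left for \<^term>\<open>f\<close> at \<^term>\<open>z\<close>. Or they differ at a single base vertex \<^term>\<open>y\<close>, where each takes the colour
  that the other one misses; then the colour of \<^term>\<open>f\<close> at \<^term>\<open>z\<close> is that of a base vertex \<^term>\<open>A j\<close>,
  and the neighbour \<^term>\<open>B j\<close> of \<^term>\<open>z\<close> is left with a colour excluded by \<^term>\<open>f' (A y)\<close>.
\<close>
lemma colour_of_proper:
  assumes inj: "inj_on (f \<circ> A) I" "inj_on (f' \<circ> A) I"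
    and BA: "\<And>i j. i \<in> I \<Longrightarrow> j \<in> I \<Longrightarrow> i \<noteq> j \<Longrightarrow> f (B i) \<noteq> f (A j)"
      "\<And>i j. i \<in> I \<Longrightarrow> j \<in> I \<Longrightarrow> i \<noteq> j \<Longrightarrow> f' (B i) \<noteq> f' (A j)"
    and Bz: "\<And>i. i \<in> I \<Longrightarrow> f (B i) \<noteq> f z"
    and w: "f w = c" "f' w = c" and x: "x \<in> I" "f (A x) = c" "f' (A x) = c"
  shows False
proof -
  note adj' = adjacent_commute [OF adj]
  obtain b where b: "b \<in> C" "b \<notin> f ` A ` I"
    using missing_colour [OF inj(1) C] by metis
  obtain b' where b': "b' \<in> C" "b' \<notin> f' ` A ` I"
    using missing_colour [OF inj(2) C] by metis
  have avoid: "f' (A k) \<noteq> b'" if "k \<in> I" for k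
    using b'(2) that by blast
  note base = base_colours [OF inj(1) C f b]
  note base' = base_colours [OF inj(2) C f' b']
  have A1: "f (A1 x) = b'"
    using base' [OF vertices_colours(6) [OF f x(1)]] adjacent_neq(7) [OF adj x(1)]
      adjacent_neq(14) [OF adj x(1)] x(3) w(2) by metis
  have A1': "f' (A1 x) = b"
    using base [OF vertices_colours(6) [OF f' x(1)]] adjacent_neq(7) [OF adj' x(1)]
      adjacent_neq(14) [OF adj' x(1)] x(2) w(1) by metis
  have B1': "f' (B1 x) = b"
    using base [OF vertices_colours(7) [OF f' x(1)]] adjacent_neq(9) [OF adj' x(1)]
      adjacent_neq(18) [OF adj' x(1)] x(2) w(1) by metis
  show False
  proof (cases "b = b'")
    case True
    have A: "f' (A k) = f (A k)" if k: "k \<in> I" for k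
      using base [OF vertices_colours(4) [OF f' k]] adjacent_neq(11) [OF adj' k] avoid [OF k] True by metis
    have B: "f' (B k) = f (A k)" if k: "k \<in> I" "x \<noteq> k" for k
      using base' [OF vertices_colours(5) [OF f' k(1)]] adjacent_neq(16) [OF adj x(1) k] A1
        BA(2) [OF k(1)] A [OF k(1)] by metis
    have z1: "f z1 = b"
      using base [OF vertices_colours(2) [OF f]] adjacent_neq(6) [OF adj] adjacent_top [OF adj] B w(2) x(2)
      by metis
    have Bx: "f' (B x) = f (A x)"
      using base' [OF vertices_colours(5) [OF f' x(1)]] adjacent_neq(6) [OF adj x(1)] z1 True
        BA(2) [OF x(1)] x by metis
    have "f z \<noteq> f (A k)" if k: "k \<in> I" for k
      using adjacent_neq(2) [OF adj k] B [OF k] Bx by (cases "x = k") auto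
    then have "f z = b"
      using base [OF vertices_colours(1) [OF f]] by blast
    then show False
      using adjacent_neq(4) [OF adj x(1)] B1' by simp
  next
    case False
    obtain y where y: "y \<in> I" "f (A y) = b'"
      using base [OF b'(1)] False by metis
    have y': "f' (A y) = b"
      using base [OF vertices_colours(4) [OF f' y(1)]] adjacent_neq(11) [OF adj' y(1)] avoid [OF y(1)] y(2)
      by metis
    have xy: "x \<noteq> y"
      using x y avoid [OF x(1)] by auto
    have By': "f' (B y) = b"
      using base [OF vertices_colours(5) [OF f' y(1)]] adjacent_neq(13) [OF adj' y(1)]
        adjacent_neq(16) [OF adj x(1) y(1) xy] A1 y(2) by metis
    have By: "f (B y) = b'"
      using base' [OF vertices_colours(5) [OF f y(1)]] adjacent_neq(13) [OF adj y(1)]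
        adjacent_neq(16) [OF adj' x(1) y(1) xy] A1' y' by metis
    have "f z \<noteq> b"
      using adjacent_neq(2) [OF adj y(1)] By' by simp
    moreover have "f z \<noteq> b'"
      using Bz [OF y(1)] By by simp
    ultimately obtain j where j: "j \<in> I" "f z = f (A j)" "j \<noteq> y"
      using base [OF vertices_colours(1) [OF f]] y(2) by metis
    have "f (B j) = b"
      using base [OF vertices_colours(5) [OF f j(1)]] BA(1) [OF j(1)] Bz [OF j(1)] j(2) by metis
    then show False
      using adjacent_neq(13) [OF adj j(1) y(1) j(3)] y' by simp
  qed
qed

end

text \<open>
  Two adjacent maps cannot get the same colour. Unless both of them are proper on the inner part, the colour of one of
  them violates properness, and one of the lemmas above applies, if necessary with the roles exchanged.
\<close>
theorem frame_colour_neq: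
  assumes C: "finite C" "card C = Suc (card I)"
    and f: "f ` vertices \<subseteq> C" and f': "f' ` vertices \<subseteq> C" and adj: "adjacent f f'"
  shows "frame_colour f \<noteq> frame_colour f'"
proof
  assume eq: "frame_colour f = frame_colour f'"
  define c where "c = frame_colour f"
  have cf: "frame_colour f = c" "frame_colour f' = c"
    using eq by (simp_all add: c_def)
  note adj' = adjacent_commute [OF adj]
  have not: "\<not> repeated f c" "\<not> crossing f c" "\<forall>i\<in>I. f (B i) \<noteq> c \<or> f z \<noteq> c"
    using colour_of_repeated [OF C f f' adj] colour_of_crossing [OF C f f' adj]
      colour_of_apex [OF C f f' adj] cf by blast+
  have not': "\<not> repeated f' c" "\<not> crossing f' c" "\<forall>i\<in>I. f' (B i) \<noteq> c \<or> f' z \<noteq> c"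
    using colour_of_repeated [OF C f' f adj'] colour_of_crossing [OF C f' f adj']
      colour_of_apex [OF C f' f adj'] cf by blast+
  note proper = proper_mapD [OF cf(1) not] and proper' = proper_mapD [OF cf(2) not']
  obtain x where x: "x \<in> I" "f (A x) = c"
    using base_takes_apex_colour [OF C f f' adj proper(1,2) proper'(2)] by blast
  obtain y where y: "y \<in> I" "f' (A y) = c"
    using base_takes_apex_colour [OF C f' f adj' proper'(1,2) proper(2)] by blast
  have "x = y"
    using adjacent_neq(11) [OF adj x(1) y(1)] x(2) y(2) by auto
  with colour_of_proper [OF C f f' adj proper(1) proper'(1) proper(3) proper'(3) proper(4) proper(2) proper'(2) x] y
  show False
    by simp
qed

end

section \<open>Chromatic numbers and test inequalities\<close>

lemma colouring_exists:
  fixes H :: "'b pair_pre_digraph"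
  assumes "pair_graph H"
  shows "\<exists>c. graph_hom H (complete_graph (chromatic_number H)) c"
proof -
  interpret pair_graph H by fact
  obtain h :: "'b \<Rightarrow> nat" where h: "bij_betw h (pverts H) {0..<card (pverts H)}"
    using ex_bij_betw_finite_nat [OF pair_finite_verts] by blast
  have "graph_hom H (complete_graph (card (pverts H))) (\<lambda>v. Suc (h v))"
    unfolding graph_hom_def
  proof (intro conjI ballI)
    have range: "Suc (h v) \<in> {1..card (pverts H)}" if "v \<in> pverts H" for v
      using bij_betwE [OF h] that by (simp add: Suc_le_eq)
    then show "(\<lambda>v. Suc (h v)) ` pverts H \<subseteq> pverts (complete_graph (card (pverts H)))"
      by (auto simp: complete_graph_def)
    fix e assume e: "e \<in> parcs H"
    obtain x y where xy: "e = (x, y)"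
      by fastforce
    have "x \<in> pverts H" "y \<in> pverts H" "x \<noteq> y"
      using e arc_fst_in_verts [OF e] arc_snd_in_verts [OF e] pair_no_loops [OF e] by (auto simp: xy)
    moreover from this have "h x \<noteq> h y"
      using h by (auto simp: bij_betw_def inj_on_def)
    ultimately show "case e of (x, y) \<Rightarrow> (Suc (h x), Suc (h y)) \<in> parcs (complete_graph (card (pverts H)))"
      using range [of x] range [of y] by (simp add: xy complete_graph_def)
  qed
  then have "\<exists>n. \<exists>c. graph_hom H (complete_graph n) c"
    by blast
  then show ?thesis
    unfolding chromatic_number_def by (rule LeastI_ex)
qed

lemma graph_hom_compose:
  assumes "graph_hom G H f" "graph_hom H K g"
  shows "graph_hom G K (g \<circ> f)"
  using assms unfolding graph_hom_def by fastforce

lemma complete_graph_hom_le: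
  assumes "graph_hom (complete_graph m) (complete_graph n) f"
  shows "m \<le> n"
proof -
  have "inj_on f {1..m}"
    using assms by (fastforce simp: inj_on_def graph_hom_def complete_graph_def)
  moreover have "f ` {1..m} \<subseteq> {1..n}"
    using assms by (auto simp: graph_hom_def complete_graph_def)
  ultimately show ?thesis
    using card_inj_on_le [of f "{1..m}" "{1..n}"] by simp
qed

lemma chromatic_number_eq:
  assumes "graph_hom (complete_graph m) T \<kappa>" "graph_hom T (complete_graph m) \<rho>"
  shows "chromatic_number T = m"
  unfolding chromatic_number_def
proof (rule Least_equality)
  show "\<exists>f. graph_hom T (complete_graph m) f"
    using assms by blast
  show "m \<le> n" if "\<exists>f. graph_hom T (complete_graph n) f" for n
    using that graph_hom_compose [OF assms(1)] complete_graph_hom_le by blast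
qed

text \<open>
  A graph that retracts onto a complete graph inherits its test property: pulling back along the two
  homomorphisms exhibits the Hom complex of the complete graph as a retract of the Hom complex of \<^term>\<open>T\<close>, so
  it is at least as connected, and both graphs have the same chromatic number.
\<close>
theorem test_inequality_of_retraction:
  assumes T: "pair_wf_digraph T" and m: "2 \<le> m"
    and \<kappa>: "graph_hom (complete_graph m) T \<kappa>" and \<rho>: "graph_hom T (complete_graph m) \<rho>"
    and retract: "\<And>i. i \<in> {1..m} \<Longrightarrow> \<rho> (\<kappa> i) = i"
    and H: "pair_graph H"
  shows "test_inequality T H"
proof (cases "topspace (hom_complex T H) = {}")
  case True
  then show ?thesis
    by (simp add: test_inequality_def conn_def)
next
  case False
  define r where "r = chromatic_number H"
  obtain c where c: "graph_hom H (complete_graph r) c"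
    using colouring_exists [OF H] by (auto simp: r_def)
  have fin: "finite (pverts H)"
    using H by (simp add: pair_graph_def pair_digraph_def pair_fin_digraph.pair_finite_verts)
  let ?X = "hom_complex T H" and ?Y = "hom_complex (complete_graph m) H"
  have cont_\<kappa>: "continuous_map ?X ?Y (hom_pullback (complete_graph m) \<kappa>)"
    by (rule continuous_map_hom_pullback [OF pair_wf_complete_graph \<kappa>])
  have cont_\<rho>: "continuous_map ?Y ?X (hom_pullback T \<rho>)"
    by (rule continuous_map_hom_pullback [OF T \<rho>])
  have retraction: "hom_pullback (complete_graph m) \<kappa> (hom_pullback T \<rho> p) = p"
    if p: "p \<in> topspace ?Y" for p
  proof
    fix i
    show "hom_pullback (complete_graph m) \<kappa> (hom_pullback T \<rho> p) i = p i"
    proof (cases "i \<in> {1..m}")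
      case True
      then have "\<kappa> i \<in> pverts T"
        using \<kappa> by (auto simp: graph_hom_def complete_graph_def)
      then show ?thesis
        using True retract [OF True] by (simp add: hom_pullback_def complete_graph_def)
    next
      case False
      then have "i \<notin> pverts (complete_graph m)"
        by (simp add: complete_graph_def)
      then show ?thesis
        using entry_outside [OF p] by (simp add: hom_pullback_def)
    qed
  qed
  have ne: "topspace ?Y \<noteq> {}"
    using False cont_\<kappa> by (auto simp: continuous_map_def Pi_iff)
  have bound: "int m + k + 1 \<le> int r" if "k_connected k ?X" for k
  proof (rule complete_graph_connectivity_bound [OF fin c m ne])
    show "k_connected k ?Y"
      by (rule k_connected_retract [OF that cont_\<kappa> cont_\<rho>]) (rule retraction)
  qed
  have "conn ?X \<le> ereal (real r - real m - 1)"
    unfolding conn_def if_not_P [OF False]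
  proof (rule Sup_least)
    fix x assume "x \<in> {ereal (of_int k) |k. k_connected k ?X}"
    then obtain k where k: "x = ereal (of_int k)" "k_connected k ?X"
      by blast
    have "real_of_int k \<le> real r - real m - 1"
      using bound [OF k(2)] by linarith
    then show "x \<le> ereal (real r - real m - 1)"
      by (simp add: k)
  qed
  then have "ereal (real m) + conn ?X + 1 \<le> ereal (real m) + ereal (real r - real m - 1) + 1"
    by (intro add_mono order_refl)
  also have "\<dots> = ereal (real r)"
    by (simp add: one_ereal_def)
  finally show ?thesis
    by (simp add: test_inequality_def chromatic_number_eq [OF \<kappa> \<rho>] r_def)
qed

section \<open>Hom complexes of a single vertex\<close>

text \<open>
  Every map from a sphere extends radially. On the ball of radius 1/2 the extension is constant, which
  keeps the radial projection away from the origin.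
\<close>
lemma k_connected_convex:
  fixes S :: "('a \<Rightarrow> 'b \<Rightarrow> real) set"
  assumes S: "S \<noteq> {}" and convex: "\<And>p q u. p \<in> S \<Longrightarrow> q \<in> S \<Longrightarrow> 0 \<le> u \<Longrightarrow> u \<le> 1 \<Longrightarrow>
      (\<lambda>v w. u * p v w + (1 - u) * q v w) \<in> S"
  shows "k_connected k (top_of_set S)"
  unfolding k_connected_def
proof (intro allI impI)
  fix j and f assume f: "continuous_map (nsphere j) (top_of_set S) f"
  obtain q where q: "q \<in> S"
    using S by blast
  define R where "R x = sqrt (\<Sum>i\<le>j. (x i)\<^sup>2)" for x :: "nat \<Rightarrow> real"
  have cont_R: "continuous_map (nball (Suc j)) euclideanreal R"
    unfolding R_def nball_powertop
    by (intro continuous_map_sqrt continuous_map_sum continuous_map_real_pow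
      continuous_map_from_subtopology continuous_map_product_projection) auto
  define h where "h x = (\<lambda>v w. (2 * R x - 1) * f (sphere_proj j x) v w + (1 - (2 * R x - 1)) * q v w)" for x
  let ?outer = "subtopology (nball (Suc j)) {x \<in> topspace (nball (Suc j)). 1 / 2 \<le> R x}"
  have R1: "R x \<le> 1" if "x \<in> topspace (nball (Suc j))" for x
    using that by (simp add: nball_powertop R_def lessThan_Suc_atMost)
  have "continuous_map ?outer (subtopology (powertop_real UNIV) {x. \<exists>i\<le>j. x i \<noteq> 0}) (\<lambda>x. x)"
    unfolding continuous_map_in_subtopology
  proof
    show "continuous_map ?outer (powertop_real UNIV) (\<lambda>x. x)"
      unfolding nball_powertop by (intro continuous_map_from_subtopology) (simp add: continuous_map_id [unfolded id_def])
    have "\<exists>i\<le>j. x i \<noteq> 0" if "1 / 2 \<le> R x" for x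
    proof (rule ccontr)
      assume "\<not> ?thesis"
      then have "R x = 0"
        by (simp add: R_def)
      then show False
        using that by simp
    qed
    then show "(\<lambda>x. x) \<in> topspace ?outer \<rightarrow> {x. \<exists>i\<le>j. x i \<noteq> 0}"
      by auto
  qed
  from continuous_map_compose [OF continuous_map_compose [OF this continuous_map_sphere_proj] f]
  have f_proj: "continuous_map ?outer (top_of_set S) (\<lambda>x. f (sphere_proj j x))"
    by (simp add: o_def)
  have f_entry: "continuous_map ?outer euclideanreal (\<lambda>x. f (sphere_proj j x) v w)" for v w
  proof -
    have "continuous_map (top_of_set S) euclideanreal (\<lambda>p. p v w)"
      by (simp add: continuous_on_entry)
    from continuous_map_compose [OF f_proj this] show ?thesis
      by (simp add: o_def)
  qed
  have cont_h: "continuous_map ?outer (top_of_set S) h"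
    unfolding continuous_map_in_subtopology
  proof
    have "continuous_map ?outer euclideanreal (\<lambda>x. h x v w)" for v w
      unfolding h_def
      by (intro continuous_map_add continuous_map_real_mult continuous_map_diff f_entry
        continuous_map_from_subtopology [OF cont_R]) auto
    then show "continuous_map ?outer euclidean h"
      by (simp flip: euclidean_product_topology add: continuous_map_componentwise_UNIV)
    have "h x \<in> S" if x: "x \<in> topspace ?outer" for x
    proof -
      have "f (sphere_proj j x) \<in> S"
        using f_proj x by (auto simp: continuous_map_def Pi_iff)
      then show ?thesis
        unfolding h_def using x q R1 [of x] by (intro convex) auto
    qed
    then show "h \<in> topspace ?outer \<rightarrow> S"
      by blast
  qed
  have "continuous_map (nball (Suc j)) (top_of_set S) (\<lambda>x. if R x \<le> 1 / 2 then q else h x)"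
  proof (rule continuous_map_cases_le [OF cont_R _ _ cont_h])
    show "q = h x" if "R x = 1 / 2" for x
      by (simp only: h_def that) simp
  qed (use q in auto)
  moreover have "(if R x \<le> 1 / 2 then q else h x) = f x" if x: "x \<in> topspace (nsphere j)" for x
  proof -
    have "R x = 1" "sphere_proj j x = x"
      using x by (auto simp: R_def nsphere_topspace sphere_proj_def)
    then show ?thesis
      by (simp add: h_def)
  qed
  ultimately show "\<exists>g. continuous_map (nball (Suc j)) (top_of_set S) g \<and>
      (\<forall>x\<in>topspace (nsphere j). g x = f x)"
    by blast
qed

text \<open>
  The complex is the full simplex on the vertices of \<^term>\<open>H\<close>.
\<close>
lemma conn_hom_complex_singleton:
  assumes T: "pverts T = {t}" "parcs T = {}" and H: "finite (pverts H)" "pverts H \<noteq> {}"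
  shows "conn (hom_complex T H) = \<infinity>"
proof -
  define S where "S = {p :: 'a \<Rightarrow> 'b \<Rightarrow> real. p t \<in> simplex_on (pverts H) \<and> (\<forall>v. v \<noteq> t \<longrightarrow> p v = (\<lambda>w. 0))}"
  have "(\<Union>\<eta>\<in>hom_cells T H. hom_closed_cell T \<eta>) = S"
  proof (intro equalityI subsetI)
    fix p assume "p \<in> (\<Union>\<eta>\<in>hom_cells T H. hom_closed_cell T \<eta>)"
    then obtain \<eta> where \<eta>: "\<eta> t \<subseteq> pverts H" "p t \<in> simplex_on (\<eta> t)" "\<forall>v. v \<noteq> t \<longrightarrow> p v = (\<lambda>w. 0)"
      by (auto simp: hom_cells_def hom_closed_cell_def T PiE_iff)
    moreover have "(\<Sum>w\<in>pverts H. p t w) = (\<Sum>w\<in>\<eta> t. p t w)"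
      using H \<eta> by (intro sum.mono_neutral_right) (auto simp: simplex_on_def)
    ultimately show "p \<in> S"
      by (auto simp: S_def simplex_on_def)
  next
    fix p assume p: "p \<in> S"
    have "(\<lambda>v\<in>{t}. pverts H) \<in> hom_cells T H"
      using H by (simp add: hom_cells_def T)
    moreover have "p \<in> hom_closed_cell T (\<lambda>v\<in>{t}. pverts H)"
      using p by (simp add: hom_closed_cell_def T S_def)
    ultimately show "p \<in> (\<Union>\<eta>\<in>hom_cells T H. hom_closed_cell T \<eta>)"
      by blast
  qed
  then have X: "hom_complex T H = top_of_set S"
    by (simp add: hom_complex_def)
  obtain w0 where w0: "w0 \<in> pverts H"
    using H by blast
  have "(\<lambda>v w. if v = t \<and> w = w0 then 1 else 0) \<in> S"
    using w0 H by (auto simp: S_def simplex_on_def fun_eq_iff)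
  then have ne: "S \<noteq> {}"
    by blast
  have kc: "k_connected k (hom_complex T H)" for k
    unfolding X
  proof (rule k_connected_convex [OF ne])
    fix p q and u :: real assume "p \<in> S" "q \<in> S" "0 \<le> u" "u \<le> 1"
    then show "(\<lambda>v w. u * p v w + (1 - u) * q v w) \<in> S"
      by (simp add: S_def simplex_on_def sum.distrib flip: sum_distrib_left)
  qed
  show ?thesis
  proof (rule ereal_top)
    fix B :: real
    have "ereal B \<le> ereal (of_int \<lceil>B\<rceil>)"
      by simp
    also have "\<dots> \<le> Sup {ereal (of_int k) |k. k_connected k (hom_complex T H)}"
      using kc by (intro Sup_upper) blast
    also have "\<dots> = conn (hom_complex T H)"
      using ne by (simp add: conn_def X)
    finally show "ereal B \<le> conn (hom_complex T H)" .
  qed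
qed

text \<open>
  Only the graph without vertices escapes the preceding lemma, and its Hom complex is empty.
\<close>
lemma test_inequality_singleton:
  assumes T: "pverts T = {t}" "parcs T = {}" and H: "pair_graph H"
    and conn: "conn (hom_complex T H) \<noteq> \<infinity>"
  shows "test_inequality T H"
proof -
  have "finite (pverts H)"
    using H by (simp add: pair_graph_def pair_digraph_def pair_fin_digraph.pair_finite_verts)
  then have "pverts H = {}"
    using conn_hom_complex_singleton [OF T] conn by blast
  then have "hom_cells T H = {}"
    by (auto simp: hom_cells_def T PiE_iff)
  then show ?thesis
    by (simp add: test_inequality_def conn_def topspace_hom_complex)
qed

section \<open>Mycielskians and exponential graphs\<close>

text \<open>
  The class of \<^term>\<open>(g, t)\<close> in the quotient that defines the Mycielskian.
\<close>
definition mycielski_vertex :: "'a pair_pre_digraph \<Rightarrow> 'a \<Rightarrow> nat \<Rightarrow> ('a \<times> nat) set" where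
  "mycielski_vertex G g t =
     {y \<in> pverts (graph_prod G L2_graph). y = (g, t) \<or> t = 2 \<and> snd y = 2}"

lemma mycielski_vertex_in:
  assumes "g \<in> pverts G" "t \<in> {0, 1, 2}"
  shows "mycielski_vertex G g t \<in> pverts (mycielskian G)"
proof -
  let ?r = "{(x, y). x \<in> pverts (graph_prod G L2_graph) \<and> y \<in> pverts (graph_prod G L2_graph) \<and>
      (x = y \<or> snd x = 2 \<and> snd y = 2)}"
  have gt: "(g, t) \<in> pverts (graph_prod G L2_graph)"
    using assms by (auto simp: graph_prod_def L2_graph_def)
  then have eq: "mycielski_vertex G g t = ?r `` {(g, t)}"
    by (auto simp: mycielski_vertex_def)
  show ?thesis
    unfolding eq mycielskian_def graph_quotient_def
    using quotientI [OF gt] by (simp only: pair_pre_digraph.select_convs)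
qed

lemma mycielski_apex:
  assumes "g \<in> pverts G" "g' \<in> pverts G"
  shows "mycielski_vertex G g 2 = mycielski_vertex G g' 2"
  using assms by (auto simp: mycielski_vertex_def)

lemma mycielski_edge:
  assumes G: "pair_wf_digraph G" and g: "(g, g') \<in> parcs G" and t: "(t, t') \<in> parcs L2_graph"
  shows "(mycielski_vertex G g t, mycielski_vertex G g' t') \<in> parcs (mycielskian G)"
proof -
  have gV: "g \<in> pverts G" "g' \<in> pverts G"
    using pair_wf_digraph.in_arcsD1 [OF G g] pair_wf_digraph.in_arcsD2 [OF G g] .
  have tV: "t \<in> {0, 1, 2}" "t' \<in> {0, 1, 2}"
    using t by (auto simp: L2_graph_def)
  have "(g, t) \<in> mycielski_vertex G g t" "(g', t') \<in> mycielski_vertex G g' t'"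
    using gV tV by (auto simp: mycielski_vertex_def graph_prod_def L2_graph_def)
  moreover have "((g, t), (g', t')) \<in> parcs (graph_prod G L2_graph)"
    using g t by (simp add: graph_prod_def)
  ultimately show ?thesis
    using mycielski_vertex_in [OF gV(1) tV(1)] mycielski_vertex_in [OF gV(2) tV(2)]
    unfolding mycielskian_def graph_quotient_def by auto
qed

lemma pair_wf_mycielskian: "pair_wf_digraph (mycielskian G)"
  by unfold_locales (auto simp: mycielskian_def graph_quotient_def)

lemma L2_edges: "(0, 0) \<in> parcs L2_graph" "(0, 1) \<in> parcs L2_graph" "(1, 0) \<in> parcs L2_graph"
  "(1, 2) \<in> parcs L2_graph"
  by (simp_all add: L2_graph_def)

lemma contains_copyE:
  assumes "contains_copy G M"
  obtains \<iota> where "\<And>x y. (x, y) \<in> parcs M \<Longrightarrow> (\<iota> x, \<iota> y) \<in> parcs G"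
proof -
  obtain H where sub: "subgraph (with_proj H) (with_proj G)"
    and iso: "digraph_iso (with_proj M) (with_proj H)"
    using assms by (auto simp: contains_copy_def)
  obtain h where h: "pre_digraph.digraph_isomorphism (with_proj M) h"
    and H: "with_proj H = app_iso h (with_proj M)"
    using iso by (auto simp: digraph_iso_def)
  have arcs: "parcs H = iso_arcs h ` parcs M" and tail: "iso_tail h = fst" and head: "iso_head h = snd"
    using arg_cong [OF H, of arcs] arg_cong [OF H, of tail] arg_cong [OF H, of head]
    by (simp_all add: app_iso_def)
  have "(iso_verts h x, iso_verts h y) \<in> parcs G" if xy: "(x, y) \<in> parcs M" for x y
  proof -
    have "iso_verts h x = fst (iso_arcs h (x, y))" "iso_verts h y = snd (iso_arcs h (x, y))"
      using h xy unfolding pre_digraph.digraph_isomorphism_def by (auto simp: tail head)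
    then have "(iso_verts h x, iso_verts h y) = iso_arcs h (x, y)"
      by simp
    also have "\<dots> \<in> parcs G"
      using sub xy by (auto simp: subgraph_def arcs)
    finally show ?thesis .
  qed
  then show ?thesis
    by (rule that)
qed

text \<open>
  The edges from the level 1 copies to the apex come from neighbours that may lie outside of the index set.
\<close>
lemma mycielski_frame_in_copy:
  assumes n: "2 \<le> n" and G: "sym (parcs G)" and I: "I \<subseteq> {1..n}"
    and copy: "contains_copy G (mycielskian (mycielskian (complete_graph n)))"
  shows "\<exists>A B A1 B1 z z1 w. mycielski_frame I (parcs G) A B A1 B1 z z1 w"
proof -
  define K where "K = complete_graph n"
  define N where "N = mycielskian K"
  obtain \<iota> where \<iota>: "\<And>x y. (x, y) \<in> parcs (mycielskian N) \<Longrightarrow> (\<iota> x, \<iota> y) \<in> parcs G"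
    using contains_copyE [OF copy] by (metis K_def N_def)
  have wfK: "pair_wf_digraph K" and wfN: "pair_wf_digraph N"
    by (simp_all add: K_def N_def pair_wf_complete_graph pair_wf_mycielskian)
  have K: "(i, j) \<in> parcs K" if "i \<in> I" "j \<in> I" "i \<noteq> j" for i j
    using that I by (auto simp: K_def complete_graph_def)
  define a where "a i = mycielski_vertex K i 0" for i
  define b where "b i = mycielski_vertex K i 1" for i
  define y where "y = mycielski_vertex K 1 2"
  have N: "(a i, a j) \<in> parcs N" "(a i, b j) \<in> parcs N" "(b i, a j) \<in> parcs N"
    if "i \<in> I" "j \<in> I" "i \<noteq> j" for i j
    unfolding a_def b_def N_def by (intro mycielski_edge wfK K that L2_edges)+
  have other: "\<exists>j\<in>{1..n}. i \<noteq> j" for i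
    using n by (intro bexI [of _ "if i = 1 then 2 else 1"]) auto
  have Ny: "(b i, y) \<in> parcs N" if "i \<in> {1..n}" for i
  proof -
    obtain j where j: "j \<in> {1..n}" "i \<noteq> j"
      using other by blast
    then have "(b i, mycielski_vertex K j 2) \<in> parcs N"
      unfolding b_def N_def using that
      by (intro mycielski_edge wfK L2_edges) (auto simp: K_def complete_graph_def)
    moreover have "mycielski_vertex K j 2 = y"
      unfolding y_def using j n by (intro mycielski_apex) (auto simp: K_def complete_graph_def)
    ultimately show ?thesis
      by simp
  qed
  have Na: "\<exists>x. (a i, x) \<in> parcs N" if "i \<in> {1..n}" for i
  proof -
    obtain j where j: "j \<in> {1..n}" "i \<noteq> j"
      using other by blast
    then have "(a i, a j) \<in> parcs N"
      unfolding a_def N_def using that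
      by (intro mycielski_edge wfK L2_edges) (auto simp: K_def complete_graph_def)
    then show ?thesis
      by blast
  qed
  define E where "E x s x' s' = (\<iota> (mycielski_vertex N x s), \<iota> (mycielski_vertex N x' s'))" for x s x' s'
  have E: "E x s x' s' \<in> parcs G" if "(x, x') \<in> parcs N" "(s, s') \<in> parcs L2_graph" for x s x' s'
    unfolding E_def by (intro \<iota> mycielski_edge wfN that)
  define W where "W = mycielski_vertex N y 2"
  have y: "y \<in> pverts N"
    using pair_wf_digraph.in_arcsD2 [OF wfN Ny [of 1]] n by simp
  have top: "(\<iota> (mycielski_vertex N x 1), \<iota> W) \<in> parcs G" if "(x, x') \<in> parcs N" for x x'
  proof -
    have "mycielski_vertex N x' 2 = W"
      unfolding W_def using pair_wf_digraph.in_arcsD2 [OF wfN that] y by (rule mycielski_apex)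
    then show ?thesis
      using E [OF that L2_edges(4)] by (simp add: E_def)
  qed
  have y_b: "(y, b 1) \<in> parcs N"
  proof -
    obtain j where j: "j \<in> {1..n}" "1 \<noteq> j"
      using other by blast
    then have "(mycielski_vertex K j 2, b 1) \<in> parcs N"
      unfolding b_def N_def using n
      by (intro mycielski_edge wfK) (auto simp: K_def complete_graph_def L2_graph_def)
    moreover have "mycielski_vertex K j 2 = y"
      unfolding y_def using j n by (intro mycielski_apex) (auto simp: K_def complete_graph_def)
    ultimately show ?thesis
      by simp
  qed
  have domain_y: "\<iota> (mycielski_vertex N y 0) \<in> Domain (parcs G)"
    using E [OF y_b L2_edges(1)] unfolding E_def by (rule DomainI)
  have domain_a: "\<iota> (mycielski_vertex N (a i) 0) \<in> Domain (parcs G)" if "i \<in> I" for i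
  proof -
    have "i \<in> {1..n}"
      using that I by blast
    then obtain x where x: "(a i, x) \<in> parcs N"
      using Na by blast
    show ?thesis
      using E [OF x L2_edges(1)] unfolding E_def by (rule DomainI)
  qed
  have "mycielski_frame I (parcs G)
      (\<lambda>i. \<iota> (mycielski_vertex N (a i) 0)) (\<lambda>i. \<iota> (mycielski_vertex N (b i) 0))
      (\<lambda>i. \<iota> (mycielski_vertex N (a i) 1)) (\<lambda>i. \<iota> (mycielski_vertex N (b i) 1))
      (\<iota> (mycielski_vertex N y 0)) (\<iota> (mycielski_vertex N y 1)) (\<iota> W)"
  proof
    show "finite I"
      using I finite_subset by blast
    show "sym (parcs G)"
      by (rule G)
    show "(\<iota> (mycielski_vertex N y 1), \<iota> W) \<in> parcs G"
      by (rule top [OF y_b])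
    show "insert (\<iota> (mycielski_vertex N y 0)) ((\<lambda>i. \<iota> (mycielski_vertex N (a i) 0)) ` I) \<subseteq> Domain (parcs G)"
      using domain_y domain_a by auto
    fix i assume i: "i \<in> I"
    then have i': "i \<in> {1..n}"
      using I by blast
    obtain x where "(a i, x) \<in> parcs N"
      using Na [OF i'] by blast
    then show "{(\<iota> (mycielski_vertex N (b i) 0), \<iota> (mycielski_vertex N y 0)),
        (\<iota> (mycielski_vertex N (b i) 1), \<iota> (mycielski_vertex N y 0)),
        (\<iota> (mycielski_vertex N (b i) 0), \<iota> (mycielski_vertex N y 1)),
        (\<iota> (mycielski_vertex N (a i) 1), \<iota> W),
        (\<iota> (mycielski_vertex N (b i) 1), \<iota> W)} \<subseteq> parcs G"
      using E [OF Ny [OF i'] L2_edges(1)] E [OF Ny [OF i'] L2_edges(2)] E [OF Ny [OF i'] L2_edges(3)]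
        top [OF Ny [OF i']] top by (simp add: E_def)
    fix j assume j: "j \<in> I" "i \<noteq> j"
    show "{(\<iota> (mycielski_vertex N (a i) 0), \<iota> (mycielski_vertex N (a j) 0)),
        (\<iota> (mycielski_vertex N (a i) 0), \<iota> (mycielski_vertex N (b j) 0)),
        (\<iota> (mycielski_vertex N (a i) 1), \<iota> (mycielski_vertex N (a j) 0)),
        (\<iota> (mycielski_vertex N (a i) 1), \<iota> (mycielski_vertex N (b j) 0)),
        (\<iota> (mycielski_vertex N (b i) 1), \<iota> (mycielski_vertex N (a j) 0))} \<subseteq> parcs G"
      using E [OF N(1) [OF i j] L2_edges(1)] E [OF N(2) [OF i j] L2_edges(1)]
        E [OF N(1) [OF i j] L2_edges(3)] E [OF N(2) [OF i j] L2_edges(3)]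
        E [OF N(3) [OF i j] L2_edges(3)]
      by (simp add: E_def)
  qed
  then show ?thesis
    by blast
qed

text \<open>
  The colouring of the exponential graph. A constant map gets its constant as colour, since the colour
  of a map is one of its values; hence the colouring is a retraction onto the constant maps.
\<close>
lemma (in mycielski_frame) frame_colour_hom:
  assumes G: "pair_wf_digraph G" and E: "E = parcs G" and m: "m = Suc (card I)"
  shows "graph_hom (exp_graph (complete_graph m) G) (complete_graph m) frame_colour"
    and "c \<in> {1..m} \<Longrightarrow> frame_colour (\<lambda>v\<in>pverts G. c) = c"
proof -
  have wf: "x \<in> pverts G" "y \<in> pverts G" if "(x, y) \<in> E" for x y
    using pair_wf_digraph.in_arcsD1 [OF G] pair_wf_digraph.in_arcsD2 [OF G] that by (auto simp: E)
  have "Domain E \<subseteq> pverts G"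
    using wf by auto
  moreover have "B i \<in> Domain E" "A1 i \<in> Domain E" "B1 i \<in> Domain E" if "i \<in> I" for i
    using apex_edges [OF that] by auto
  moreover have "z1 \<in> Domain E" "w \<in> Domain E"
    using top_edge sym_E by (auto dest: symD)
  ultimately have verts: "vertices \<subseteq> pverts G"
    using in_domain unfolding vertices_def by blast
  have range: "f ` vertices \<subseteq> {1..m}" if "f \<in> pverts (exp_graph (complete_graph m) G)" for f
    using that verts by (auto simp: exp_graph_def complete_graph_def)
  have of_vertex: "frame_colour f \<in> f ` vertices" for f :: "'v \<Rightarrow> nat"
    using frame_colour_value [of f] by (auto simp: vertices_def)
  show "graph_hom (exp_graph (complete_graph m) G) (complete_graph m) frame_colour"
    unfolding graph_hom_def
  proof (intro conjI ballI)
    show "frame_colour ` pverts (exp_graph (complete_graph m) G) \<subseteq> pverts (complete_graph m)"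
      using of_vertex range by (fastforce simp: complete_graph_def)
    fix e assume e: "e \<in> parcs (exp_graph (complete_graph m) G)"
    obtain f f' where ff': "e = (f, f')"
      by fastforce
    have f: "f \<in> pverts (exp_graph (complete_graph m) G)" "f' \<in> pverts (exp_graph (complete_graph m) G)"
      using e by (auto simp: ff' exp_graph_def)
    have "adjacent f f'"
      using e unfolding adjacent_def by (auto simp: ff' exp_graph_def complete_graph_def E)
    then have "frame_colour f \<noteq> frame_colour f'"
      using range f m by (intro frame_colour_neq [of "{1..m}"]) auto
    then show "case e of (x, y) \<Rightarrow> (frame_colour x, frame_colour y) \<in> parcs (complete_graph m)"
      using of_vertex [of f] of_vertex [of f'] range [OF f(1)] range [OF f(2)]
      by (auto simp: ff' complete_graph_def)
  qed
  show "frame_colour (\<lambda>v\<in>pverts G. c) = c"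
    using of_vertex [of "\<lambda>v\<in>pverts G. c"] verts by auto
qed

lemma exp_graph_constants:
  assumes G: "pair_wf_digraph G"
  shows "graph_hom (complete_graph m) (exp_graph (complete_graph m) G) (\<lambda>i. \<lambda>v\<in>pverts G. i)"
proof -
  have wf: "x \<in> pverts G" "y \<in> pverts G" if "(x, y) \<in> parcs G" for x y
    using pair_wf_digraph.in_arcsD1 [OF G that] pair_wf_digraph.in_arcsD2 [OF G that] .
  show ?thesis
    using wf by (fastforce simp: graph_hom_def complete_graph_def exp_graph_def)
qed

text \<open>
  A homomorphism to a complete graph rules out loops.
\<close>
lemma pair_graph_exp_graph:
  assumes G: "pair_pseudo_graph G" and c: "graph_hom (exp_graph (complete_graph m) G) (complete_graph n) c"
  shows "pair_graph (exp_graph (complete_graph m) G)"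
proof -
  interpret G: pair_pseudo_graph G by fact
  let ?T = "exp_graph (complete_graph m) G"
  have sym: "sym (parcs G)"
    using G.pair_sym_arcs by (simp add: symmetric_def)
  have fin: "finite (pverts ?T)"
    by (simp add: exp_graph_def complete_graph_def finite_PiE G.pair_finite_verts)
  have sub: "parcs ?T \<subseteq> pverts ?T \<times> pverts ?T"
    by (auto simp: exp_graph_def)
  have "sym (parcs ?T)"
  proof (rule symI)
    fix f f' assume "(f, f') \<in> parcs ?T"
    then show "(f', f) \<in> parcs ?T"
      using sym by (fastforce simp: exp_graph_def complete_graph_def dest: symD)
  qed
  show ?thesis
  proof unfold_locales
    fix e assume e: "e \<in> parcs ?T"
    show "fst e \<in> pverts ?T" "snd e \<in> pverts ?T"
      using e sub by auto
    show "fst e \<noteq> snd e"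
      using e c by (auto simp: graph_hom_def complete_graph_def)
  next
    show "finite (pverts ?T)"
      by (rule fin)
    show "finite (parcs ?T)"
      using fin sub by (meson finite_SigmaI finite_subset)
    show "symmetric (with_proj ?T)"
      using \<open>sym (parcs ?T)\<close> by (simp add: symmetric_def)
  qed
qed

theorem corollary1p8:
  fixes n m :: nat and G :: "'a pair_pre_digraph"
  assumes "n \<ge> 2"
    and "pair_pseudo_graph G"
    and "contains_copy G (mycielskian (mycielskian (complete_graph n)))"
    and "1 \<le> m" and "m \<le> n + 1"
  shows "homotopy_test_graph TYPE('b) (exp_graph (complete_graph m) G) \<and>
         (2 \<le> m \<longrightarrow> strong_homotopy_test_graph TYPE('b) (exp_graph (complete_graph m) G))"
proof -
  interpret G: pair_pseudo_graph G by fact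
  have wf: "pair_wf_digraph G" ..
  let ?T = "exp_graph (complete_graph m) G"
  have "sym (parcs G)"
    using G.pair_sym_arcs by (simp add: symmetric_def)
  moreover have I: "{1..m - 1} \<subseteq> {1..n}"
    using assms(5) by auto
  ultimately obtain A B A1 B1 z z1 w where "mycielski_frame {1..m - 1} (parcs G) A B A1 B1 z z1 w"
    using mycielski_frame_in_copy [OF assms(1) _ I assms(3)] by blast
  then interpret mycielski_frame "{1..m - 1}" "parcs G" A B A1 B1 z z1 w .
  have m: "m = Suc (card {1..m - 1})"
    using assms by simp
  note \<rho> = frame_colour_hom [OF wf refl m]
  note \<kappa> = exp_graph_constants [OF wf, of m]
  have T: "pair_graph ?T"
    by (rule pair_graph_exp_graph [OF assms(2) \<rho>(1)])
  then have wf_T: "pair_wf_digraph ?T"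
    by (simp add: pair_graph_def pair_digraph_def pair_fin_digraph_def)
  have large: "test_inequality ?T H" if "2 \<le> m" "pair_graph H" for H :: "'b pair_pre_digraph"
    by (rule test_inequality_of_retraction [OF wf_T that(1) \<kappa> \<rho>(1) _ that(2)]) (rule \<rho>(2))
  have small: "test_inequality ?T H"
    if "m = 1" "pair_graph H" "conn (hom_complex ?T H) \<noteq> \<infinity>" for H :: "'b pair_pre_digraph"
  proof (rule test_inequality_singleton [OF _ _ that(2,3)])
    show "pverts ?T = {\<lambda>v\<in>pverts G. 1}"
      using that(1) by (auto simp: exp_graph_def complete_graph_def PiE_iff extensional_def fun_eq_iff)
    show "parcs ?T = {}"
      using \<rho>(1) that(1) by (auto simp: graph_hom_def complete_graph_def)
  qed
  show ?thesis
    using T large small assms(4)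
    unfolding homotopy_test_graph_def strong_homotopy_test_graph_def
    by (metis One_nat_def Suc_leI le_neq_implies_less numeral_2_eq_2)
qed

end
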